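(* Let $F=\alpha^{1+m}\beta^{-m}$ be a properly Finslerian $m$-Kropina metric of Berwald type on a manifold $M$ with $n=\dim M>2$, and let $f^i$ be the smooth vector field on $M$ satisfying $$\mathring\nabla_jb_i=m(f_kb^k)a_{ij}+b_if_j-mf_ib_j .$$ The following are equivalent: (i) $F$ is locally metrizable; (ii) the affine Ricci tensor is symmetric, $\bar R_{ij}=\bar R_{ji}$; (iii) $f_i\,dx^i$ is a closed 1-form. In that case we can locally write $f_i=\partial_i\psi$ for some smooth function $\psi$, and define $\tilde a_{ij}=e^{-2m\psi}a_{ij}$, $\tilde b_i=e^{-(1+m)\psi}b_i$, with corresponding $\tilde\alpha=\sqrt{|\tilde a_{ij}y^iy^j|}$ and $\tilde\beta=\tilde b_iy^i$. Then $F=\tilde\alpha^{1+m}\tilde\beta^{-m}$, the 1-form $\tilde b$ is covariantly constant with respect to $\tilde a_{ij}$, and $\tilde a_{ij}$ provides a local metrization of $F$ (its Levi-Civita connection coincides locally with the affine connection of $F$).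
   Context: $M$ is a smooth manifold; coordinates $x^i$ induce coordinates $(x^i,y^i)$ on $TM$; $\partial_i=\partial/\partial x^i$, $\bar\partial_i=\partial/\partial y^i$. A conic subbundle $\mathcal A\subset TM$ is an open subset projecting onto $M$ and closed under $(x,y)\mapsto(x,\lambda y)$, $\lambda>0$. A Finsler metric on $\mathcal A$ is a smooth $F:\mathcal A\to\mathbb R$ with $F(x,\lambda y)=\lambda F(x,y)$ for $\lambda>0$ and $g_{ij}=\tfrac12\bar\partial_i\bar\partial_jF^2$ nondegenerate; put $L=F^2$. $F$ is properly Finslerian if there is no finite cover of $\mathcal A$ by sets on each of which $L$ is quadratic in $y$. The canonical nonlinear connection is $N^j_i=\tfrac14\bar\partial_i[g^{jk}(y^m\partial_m\bar\partial_kL-\partial_kL)]$; $F$ is of Berwald type if $N^k_i=\Gamma^k_{ij}(x)y^j$ on $\mathcal A$, and then $\Gamma^k_{ij}$ are the Christoffel symbols of a torsion-free affine connection on $M$, the affine connection of $F$. Its (affine) Ricci tensor is $\bar R_{lk}=\bar R^i{}_{l\,ik}$ with $\bar R^k{}_{\ell ij}=\partial_i\Gamma^k_{j\ell}-\partial_j\Gamma^k_{i\ell}+\Gamma^k_{im}\Gamma^m_{j\ell}-\Gamma^k_{jm}\Gamma^m_{i\ell}$. A Berwald space is locally metrizable if each point of $M$ has a neighborhood admitting a pseudo-Riemannian metric whose Levi-Civita connection coincides with the affine connection restricted to that neighborhood. $a_{ij}$ is a pseudo-Riemannian metric on $M$ with Levi-Civita connection $\mathring\nabla$ and Christoffel symbols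 $\mathring\Gamma^k_{ij}$, $b=b_i\,dx^i$ a smooth 1-form, $A=a_{ij}y^iy^j$, $\alpha=\sqrt{|A|}$, $\beta=b_iy^i$; indices are raised and lowered with $a_{ij}$. An $m$-Kropina metric ($m\in\mathbb R$ constant) is a Finsler metric $F=\alpha^{1+m}\beta^{-m}$, with $\mathcal A$ contained in the set where $\alpha\neq0$ and $\beta>0$ (so $b$ is nowhere vanishing). Known fact: a properly Finslerian $m$-Kropina metric with $\dim M>2$ is of Berwald type if and only if there exists a smooth vector field $f^i$ on $M$ satisfying the displayed equation for $\mathring\nabla_jb_i$; in that case the affine connection is $\Gamma^\ell_{ij}=\mathring\Gamma^\ell_{ij}+ma^{\ell k}(a_{ij}f_k-a_{jk}f_i-a_{ki}f_j)$. *)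

theory Defs
  imports "HOL-Analysis.Analysis"
begin

section \<open>Smooth maps and smooth manifolds\<close>

text \<open>On an open set \<open>S\<close>: \<open>f\<close> is of class \<open>C^k\<close>, expressed through iterated directional derivatives.\<close>

primrec Ck_on :: "nat \<Rightarrow> 'a::real_normed_vector set \<Rightarrow> ('a \<Rightarrow> 'b::real_normed_vector) \<Rightarrow> bool" where
  "Ck_on 0 S f \<longleftrightarrow> continuous_on S f"
| "Ck_on (Suc k) S f \<longleftrightarrow>
     (\<forall>x\<in>S. f differentiable (at x)) \<and> (\<forall>v. Ck_on k S (\<lambda>x. frechet_derivative f (at x) v))"

definition smooth_on :: "'a::real_normed_vector set \<Rightarrow> ('a \<Rightarrow> 'b::real_normed_vector) \<Rightarrow> bool" where
  "smooth_on S f \<longleftrightarrow> (\<forall>k. Ck_on k S f)"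

text \<open>A chart is a pair of its domain and its coordinate map; only the values of the map on the
  domain are relevant.\<close>

type_synonym ('p, 'n) chart = "'p set \<times> ('p \<Rightarrow> real ^ 'n)"

abbreviation chart_image :: "('p, 'n) chart \<Rightarrow> 'p set \<Rightarrow> (real ^ 'n) set" where
  "chart_image c U \<equiv> snd c ` (fst c \<inter> U)"

abbreviation chart_inv :: "('p, 'n) chart \<Rightarrow> real ^ 'n \<Rightarrow> 'p" where
  "chart_inv c \<equiv> inv_into (fst c) (snd c)"

abbreviation transition :: "('p, 'n) chart \<Rightarrow> ('p, 'n) chart \<Rightarrow> real ^ 'n \<Rightarrow> real ^ 'n" where
  "transition c d \<equiv> (\<lambda>x. snd d (chart_inv c x))"

definition smooth_manifold :: "'p topology \<Rightarrow> ('p, 'n::finite) chart set \<Rightarrow> bool" where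
  "smooth_manifold M atlas \<longleftrightarrow>
     Hausdorff_space M \<and> second_countable M \<and>
     (\<Union>c\<in>atlas. fst c) = topspace M \<and>
     (\<forall>c\<in>atlas. openin M (fst c) \<and> open (snd c ` fst c) \<and>
        homeomorphic_map (subtopology M (fst c)) (top_of_set (snd c ` fst c)) (snd c)) \<and>
     (\<forall>c\<in>atlas. \<forall>d\<in>atlas. smooth_on (chart_image c (fst d)) (transition c d))"

definition smooth_function_on :: "('p, 'n::finite) chart set \<Rightarrow> 'p set \<Rightarrow> ('p \<Rightarrow> real) \<Rightarrow> bool" where
  "smooth_function_on atlas U h \<longleftrightarrow>
     (\<forall>c\<in>atlas. smooth_on (chart_image c U) (\<lambda>x. h (chart_inv c x)))"

definition partial :: "'n \<Rightarrow> (real ^ 'n::finite \<Rightarrow> real) \<Rightarrow> real ^ 'n \<Rightarrow> real" where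
  "partial i h x = frechet_derivative h (at x) (axis i 1)"


section \<open>Tangent vectors and tensor fields\<close>

text \<open>A tangent vector at \<open>p\<close> is the family of its component vectors in all charts around \<open>p\<close>,
  subject to the usual transformation law; the entries at all other indices are set to \<open>0\<close>, so
  that equality of tangent vectors is equality of functions.\<close>

type_synonym ('p, 'n) tvec = "('p, 'n) chart \<Rightarrow> real ^ 'n"

definition tangent_space :: "('p, 'n::finite) chart set \<Rightarrow> 'p \<Rightarrow> ('p, 'n) tvec set" where
  "tangent_space atlas p =
     {v. (\<forall>c\<in>atlas. \<forall>d\<in>atlas. p \<in> fst c \<and> p \<in> fst d \<longrightarrow>
            v d = frechet_derivative (transition c d) (at (snd c p)) (v c)) \<and>
         (\<forall>c. c \<notin> atlas \<or> p \<notin> fst c \<longrightarrow> v c = 0)}"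

abbreviation tangent_bundle :: "('p, 'n::finite) chart set \<Rightarrow> 'p set \<Rightarrow> ('p \<times> ('p, 'n) tvec) set" where
  "tangent_bundle atlas U \<equiv> Sigma U (tangent_space atlas)"

definition tvec_add :: "('p, 'n) tvec \<Rightarrow> ('p, 'n) tvec \<Rightarrow> ('p, 'n::finite) tvec" where
  "tvec_add v w = (\<lambda>c. v c + w c)"

definition tvec_scale :: "real \<Rightarrow> ('p, 'n) tvec \<Rightarrow> ('p, 'n::finite) tvec" where
  "tvec_scale r v = (\<lambda>c. r *\<^sub>R v c)"

text \<open>The tangent vector with components \<open>y\<close> in the chart \<open>c\<close>, at the point with coordinates \<open>x\<close>.\<close>

definition coord_tvec :: "('p, 'n::finite) chart set \<Rightarrow> ('p, 'n) chart \<Rightarrow> real ^ 'n \<Rightarrow> real ^ 'n \<Rightarrow> ('p, 'n) tvec" where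
  "coord_tvec atlas c x y =
     (\<lambda>d. if d \<in> atlas \<and> chart_inv c x \<in> fst d
          then frechet_derivative (transition c d) (at x) y else 0)"

abbreviation coord_basis :: "('p, 'n::finite) chart set \<Rightarrow> ('p, 'n) chart \<Rightarrow> real ^ 'n \<Rightarrow> 'n \<Rightarrow> ('p, 'n) tvec" where
  "coord_basis atlas c x i \<equiv> coord_tvec atlas c x (axis i 1)"

definition linear_form_at :: "('p, 'n::finite) chart set \<Rightarrow> 'p \<Rightarrow> (('p, 'n) tvec \<Rightarrow> real) \<Rightarrow> bool" where
  "linear_form_at atlas p \<omega> \<longleftrightarrow>
     (\<forall>v\<in>tangent_space atlas p. \<forall>w\<in>tangent_space atlas p. \<omega> (tvec_add v w) = \<omega> v + \<omega> w) \<and>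
     (\<forall>v\<in>tangent_space atlas p. \<forall>r. \<omega> (tvec_scale r v) = r * \<omega> v)"

definition sym_bilinear_form_at ::
  "('p, 'n::finite) chart set \<Rightarrow> 'p \<Rightarrow> (('p, 'n) tvec \<Rightarrow> ('p, 'n) tvec \<Rightarrow> real) \<Rightarrow> bool" where
  "sym_bilinear_form_at atlas p q \<longleftrightarrow>
     (\<forall>v\<in>tangent_space atlas p. linear_form_at atlas p (q v)) \<and>
     (\<forall>v\<in>tangent_space atlas p. \<forall>w\<in>tangent_space atlas p. q v w = q w v)"

type_synonym ('p, 'n) vector_field = "'p \<Rightarrow> ('p, 'n) tvec"
type_synonym ('p, 'n) one_form = "'p \<Rightarrow> ('p, 'n) tvec \<Rightarrow> real"
type_synonym ('p, 'n) two_tensor = "'p \<Rightarrow> ('p, 'n) tvec \<Rightarrow> ('p, 'n) tvec \<Rightarrow> real"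

definition form_comp ::
  "('p, 'n::finite) chart set \<Rightarrow> ('p, 'n) chart \<Rightarrow> ('p, 'n) one_form \<Rightarrow> 'n \<Rightarrow> real ^ 'n \<Rightarrow> real" where
  "form_comp atlas c \<omega> i x = \<omega> (chart_inv c x) (coord_basis atlas c x i)"

definition tensor_comp ::
  "('p, 'n::finite) chart set \<Rightarrow> ('p, 'n) chart \<Rightarrow> ('p, 'n) two_tensor \<Rightarrow> 'n \<Rightarrow> 'n \<Rightarrow> real ^ 'n \<Rightarrow> real" where
  "tensor_comp atlas c a i j x =
     a (chart_inv c x) (coord_basis atlas c x i) (coord_basis atlas c x j)"

definition smooth_vector_field :: "('p, 'n::finite) chart set \<Rightarrow> 'p set \<Rightarrow> ('p, 'n) vector_field \<Rightarrow> bool" where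
  "smooth_vector_field atlas U f \<longleftrightarrow>
     (\<forall>p\<in>U. f p \<in> tangent_space atlas p) \<and>
     (\<forall>c\<in>atlas. smooth_on (chart_image c U) (\<lambda>x. f (chart_inv c x) c))"

definition smooth_one_form :: "('p, 'n::finite) chart set \<Rightarrow> 'p set \<Rightarrow> ('p, 'n) one_form \<Rightarrow> bool" where
  "smooth_one_form atlas U \<omega> \<longleftrightarrow>
     (\<forall>p\<in>U. linear_form_at atlas p (\<omega> p)) \<and>
     (\<forall>c\<in>atlas. \<forall>i. smooth_on (chart_image c U) (form_comp atlas c \<omega> i))"

definition pseudo_riemannian_metric :: "('p, 'n::finite) chart set \<Rightarrow> 'p set \<Rightarrow> ('p, 'n) two_tensor \<Rightarrow> bool" where
  "pseudo_riemannian_metric atlas U a \<longleftrightarrow>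
     (\<forall>p\<in>U. sym_bilinear_form_at atlas p (a p) \<and>
        (\<forall>v\<in>tangent_space atlas p.
           (\<forall>w\<in>tangent_space atlas p. a p v w = 0) \<longrightarrow> v = (\<lambda>_. 0))) \<and>
     (\<forall>c\<in>atlas. \<forall>i j. smooth_on (chart_image c U) (tensor_comp atlas c a i j))"

definition closed_one_form :: "('p, 'n::finite) chart set \<Rightarrow> 'p set \<Rightarrow> ('p, 'n) one_form \<Rightarrow> bool" where
  "closed_one_form atlas U \<omega> \<longleftrightarrow>
     (\<forall>c\<in>atlas. \<forall>x\<in>chart_image c U. \<forall>i j.
        partial i (form_comp atlas c \<omega> j) x = partial j (form_comp atlas c \<omega> i) x)"

definition potential_on :: "('p, 'n::finite) chart set \<Rightarrow> 'p set \<Rightarrow> ('p, 'n) one_form \<Rightarrow> ('p \<Rightarrow> real) \<Rightarrow> bool" where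
  "potential_on atlas U \<omega> \<psi> \<longleftrightarrow>
     smooth_function_on atlas U \<psi> \<and>
     (\<forall>c\<in>atlas. \<forall>x\<in>chart_image c U. \<forall>i.
        form_comp atlas c \<omega> i x = partial i (\<lambda>x. \<psi> (chart_inv c x)) x)"


section \<open>Metrics, connections and curvature in coordinates\<close>

definition metric_inv ::
  "('p, 'n::finite) chart set \<Rightarrow> ('p, 'n) chart \<Rightarrow> ('p, 'n) two_tensor \<Rightarrow> 'n \<Rightarrow> 'n \<Rightarrow> real ^ 'n \<Rightarrow> real" where
  "metric_inv atlas c a i j x = matrix_inv (\<chi> k l. tensor_comp atlas c a k l x) $ i $ j"

definition lower :: "('p, 'n) two_tensor \<Rightarrow> ('p, 'n) vector_field \<Rightarrow> ('p, 'n) one_form" where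
  "lower a f = (\<lambda>p v. a p (f p) v)"

definition raised_comp ::
  "('p, 'n::finite) chart set \<Rightarrow> ('p, 'n) chart \<Rightarrow> ('p, 'n) two_tensor \<Rightarrow> ('p, 'n) one_form \<Rightarrow> 'n \<Rightarrow> real ^ 'n \<Rightarrow> real" where
  "raised_comp atlas c a \<omega> i x = (\<Sum>j\<in>UNIV. metric_inv atlas c a i j x * form_comp atlas c \<omega> j x)"

text \<open>Connection coefficients in a chart: \<open>\<Gamma> k i j x\<close> stands for \<open>\<Gamma>\<close> with upper index \<open>k\<close> and lower
  indices \<open>i\<close>, \<open>j\<close>.\<close>

type_synonym 'n conn = "'n \<Rightarrow> 'n \<Rightarrow> 'n \<Rightarrow> real ^ 'n \<Rightarrow> real"

definition levi_civita ::
  "('p, 'n::finite) chart set \<Rightarrow> ('p, 'n) two_tensor \<Rightarrow> ('p, 'n) chart \<Rightarrow> 'n conn" where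
  "levi_civita atlas a c k i j x =
     (\<Sum>l\<in>UNIV. metric_inv atlas c a k l x / 2 *
        (partial i (tensor_comp atlas c a l j) x + partial j (tensor_comp atlas c a i l) x
         - partial l (tensor_comp atlas c a i j) x))"

text \<open>\<open>cov_deriv atlas c \<Gamma> \<omega> j i\<close> is the component \<open>\<nabla>\<^sub>j \<omega>\<^sub>i\<close>.\<close>

definition cov_deriv ::
  "('p, 'n::finite) chart set \<Rightarrow> ('p, 'n) chart \<Rightarrow> 'n conn \<Rightarrow> ('p, 'n) one_form \<Rightarrow> 'n \<Rightarrow> 'n \<Rightarrow> real ^ 'n \<Rightarrow> real" where
  "cov_deriv atlas c \<Gamma> \<omega> j i x =
     partial j (form_comp atlas c \<omega> i) x - (\<Sum>k\<in>UNIV. \<Gamma> k j i x * form_comp atlas c \<omega> k x)"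

definition covariantly_constant ::
  "('p, 'n::finite) chart set \<Rightarrow> 'p set \<Rightarrow> ('p, 'n) two_tensor \<Rightarrow> ('p, 'n) one_form \<Rightarrow> bool" where
  "covariantly_constant atlas U a \<omega> \<longleftrightarrow>
     (\<forall>c\<in>atlas. \<forall>x\<in>chart_image c U. \<forall>i j. cov_deriv atlas c (levi_civita atlas a c) \<omega> j i x = 0)"

text \<open>\<open>curvature \<Gamma> k l i j\<close>: upper index \<open>k\<close>, lower indices \<open>l\<close>, \<open>i\<close>, \<open>j\<close>, the last two being
  the antisymmetric pair.\<close>

definition curvature :: "('n::finite) conn \<Rightarrow> 'n \<Rightarrow> 'n \<Rightarrow> 'n \<Rightarrow> 'n \<Rightarrow> real ^ 'n \<Rightarrow> real" where
  "curvature \<Gamma> k l i j x =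
     partial i (\<Gamma> k j l) x - partial j (\<Gamma> k i l) x
     + (\<Sum>m\<in>UNIV. \<Gamma> k i m x * \<Gamma> m j l x) - (\<Sum>m\<in>UNIV. \<Gamma> k j m x * \<Gamma> m i l x)"

definition ricci :: "('n::finite) conn \<Rightarrow> 'n \<Rightarrow> 'n \<Rightarrow> real ^ 'n \<Rightarrow> real" where
  "ricci \<Gamma> l k x = (\<Sum>i\<in>UNIV. curvature \<Gamma> i l i k x)"


section \<open>Finsler metrics\<close>

text \<open>Induced coordinates \<open>(x, y)\<close> on the tangent bundle.\<close>

definition coord_pt ::
  "('p, 'n::finite) chart set \<Rightarrow> ('p, 'n) chart \<Rightarrow> (real ^ 'n) \<times> (real ^ 'n) \<Rightarrow> 'p \<times> ('p, 'n) tvec" where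
  "coord_pt atlas c = (\<lambda>(x, y). (chart_inv c x, coord_tvec atlas c x y))"

definition coord_dom ::
  "('p, 'n::finite) chart set \<Rightarrow> ('p, 'n) chart \<Rightarrow> ('p \<times> ('p, 'n) tvec) set \<Rightarrow> ((real ^ 'n) \<times> (real ^ 'n)) set" where
  "coord_dom atlas c D = {z. fst z \<in> snd c ` fst c \<and> coord_pt atlas c z \<in> D}"

definition conic_subbundle ::
  "'p topology \<Rightarrow> ('p, 'n::finite) chart set \<Rightarrow> ('p \<times> ('p, 'n) tvec) set \<Rightarrow> bool" where
  "conic_subbundle M atlas D \<longleftrightarrow>
     D \<subseteq> tangent_bundle atlas (topspace M) \<and>
     (\<forall>c\<in>atlas. open (coord_dom atlas c D)) \<and>
     fst ` D = topspace M \<and>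
     (\<forall>(p, v)\<in>D. \<forall>r>0. (p, tvec_scale r v) \<in> D)"

definition partial_x :: "'n \<Rightarrow> ((real ^ 'n::finite) \<times> (real ^ 'n) \<Rightarrow> real) \<Rightarrow> (real ^ 'n) \<times> (real ^ 'n) \<Rightarrow> real" where
  "partial_x i h z = frechet_derivative h (at z) (axis i 1, 0)"

definition partial_y :: "'n \<Rightarrow> ((real ^ 'n::finite) \<times> (real ^ 'n) \<Rightarrow> real) \<Rightarrow> (real ^ 'n) \<times> (real ^ 'n) \<Rightarrow> real" where
  "partial_y i h z = frechet_derivative h (at z) (0, axis i 1)"

definition fundamental_tensor ::
  "((real ^ 'n::finite) \<times> (real ^ 'n) \<Rightarrow> real) \<Rightarrow> (real ^ 'n) \<times> (real ^ 'n) \<Rightarrow> real ^ 'n ^ 'n" where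
  "fundamental_tensor L z = (\<chi> i j. 1 / 2 * partial_y i (partial_y j L) z)"

text \<open>Coordinate expression of \<open>L = F\<^sup>2\<close>.\<close>

definition coord_L ::
  "('p, 'n::finite) chart set \<Rightarrow> ('p, 'n) chart \<Rightarrow> ('p \<times> ('p, 'n) tvec \<Rightarrow> real) \<Rightarrow> (real ^ 'n) \<times> (real ^ 'n) \<Rightarrow> real" where
  "coord_L atlas c F z = (F (coord_pt atlas c z))\<^sup>2"

definition finsler_metric ::
  "'p topology \<Rightarrow> ('p, 'n::finite) chart set \<Rightarrow> ('p \<times> ('p, 'n) tvec) set \<Rightarrow> ('p \<times> ('p, 'n) tvec \<Rightarrow> real) \<Rightarrow> bool" where
  "finsler_metric M atlas D F \<longleftrightarrow>
     conic_subbundle M atlas D \<and>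
     (\<forall>c\<in>atlas. smooth_on (coord_dom atlas c D) (\<lambda>z. F (coord_pt atlas c z))) \<and>
     (\<forall>(p, v)\<in>D. \<forall>r>0. F (p, tvec_scale r v) = r * F (p, v)) \<and>
     (\<forall>c\<in>atlas. \<forall>z\<in>coord_dom atlas c D. invertible (fundamental_tensor (coord_L atlas c F) z))"

definition quadratic_on ::
  "'p topology \<Rightarrow> ('p, 'n::finite) chart set \<Rightarrow> ('p \<times> ('p, 'n) tvec) set \<Rightarrow> ('p \<times> ('p, 'n) tvec \<Rightarrow> real) \<Rightarrow> bool" where
  "quadratic_on M atlas S L \<longleftrightarrow>
     (\<exists>q. (\<forall>p\<in>topspace M. sym_bilinear_form_at atlas p (q p)) \<and> (\<forall>(p, v)\<in>S. L (p, v) = q p v v))"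

definition properly_finslerian ::
  "'p topology \<Rightarrow> ('p, 'n::finite) chart set \<Rightarrow> ('p \<times> ('p, 'n) tvec) set \<Rightarrow> ('p \<times> ('p, 'n) tvec \<Rightarrow> real) \<Rightarrow> bool" where
  "properly_finslerian M atlas D F \<longleftrightarrow>
     \<not> (\<exists>\<S>. finite \<S> \<and> \<Union>\<S> = D \<and> (\<forall>S\<in>\<S>. quadratic_on M atlas S (\<lambda>z. (F z)\<^sup>2)))"

text \<open>\<open>nonlinear_connection L j i\<close>: upper index \<open>j\<close>, lower index \<open>i\<close>.\<close>

definition nonlinear_connection ::
  "((real ^ 'n::finite) \<times> (real ^ 'n) \<Rightarrow> real) \<Rightarrow> 'n \<Rightarrow> 'n \<Rightarrow> (real ^ 'n) \<times> (real ^ 'n) \<Rightarrow> real" where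
  "nonlinear_connection L j i z =
     1 / 4 * partial_y i
       (\<lambda>z. \<Sum>k\<in>UNIV. matrix_inv (fundamental_tensor L z) $ j $ k *
          ((\<Sum>m\<in>UNIV. snd z $ m * partial_x m (partial_y k L) z) - partial_x k L z)) z"

definition berwald_coeffs ::
  "('p, 'n::finite) chart set \<Rightarrow> ('p \<times> ('p, 'n) tvec) set \<Rightarrow> ('p \<times> ('p, 'n) tvec \<Rightarrow> real)
    \<Rightarrow> (('p, 'n) chart \<Rightarrow> 'n conn) \<Rightarrow> bool" where
  "berwald_coeffs atlas D F \<Gamma> \<longleftrightarrow>
     (\<forall>c\<in>atlas. \<forall>(x, y)\<in>coord_dom atlas c D. \<forall>k i.
        nonlinear_connection (coord_L atlas c F) k i (x, y) = (\<Sum>j\<in>UNIV. \<Gamma> c k i j x * y $ j))"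

definition berwald_type ::
  "('p, 'n::finite) chart set \<Rightarrow> ('p \<times> ('p, 'n) tvec) set \<Rightarrow> ('p \<times> ('p, 'n) tvec \<Rightarrow> real) \<Rightarrow> bool" where
  "berwald_type atlas D F \<longleftrightarrow> (\<exists>\<Gamma>. berwald_coeffs atlas D F \<Gamma>)"

text \<open>For \<open>F\<close> of Berwald type the choice is unique on the chart images, because every fibre of a
  conic subbundle is nonempty and open, and a linear function of \<open>y\<close> is determined by its values
  on an open set.\<close>

definition affine_connection ::
  "('p, 'n::finite) chart set \<Rightarrow> ('p \<times> ('p, 'n) tvec) set \<Rightarrow> ('p \<times> ('p, 'n) tvec \<Rightarrow> real)
    \<Rightarrow> ('p, 'n) chart \<Rightarrow> 'n conn" where
  "affine_connection atlas D F = (SOME \<Gamma>. berwald_coeffs atlas D F \<Gamma>)"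

definition metrizes_on ::
  "('p, 'n::finite) chart set \<Rightarrow> ('p \<times> ('p, 'n) tvec) set \<Rightarrow> ('p \<times> ('p, 'n) tvec \<Rightarrow> real)
    \<Rightarrow> 'p set \<Rightarrow> ('p, 'n) two_tensor \<Rightarrow> bool" where
  "metrizes_on atlas D F U h \<longleftrightarrow>
     pseudo_riemannian_metric atlas U h \<and>
     (\<forall>c\<in>atlas. \<forall>x\<in>chart_image c U. \<forall>k i j.
        levi_civita atlas h c k i j x = affine_connection atlas D F c k i j x)"

definition locally_metrizable ::
  "'p topology \<Rightarrow> ('p, 'n::finite) chart set \<Rightarrow> ('p \<times> ('p, 'n) tvec) set \<Rightarrow> ('p \<times> ('p, 'n) tvec \<Rightarrow> real) \<Rightarrow> bool" where
  "locally_metrizable M atlas D F \<longleftrightarrow>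
     (\<forall>p\<in>topspace M. \<exists>U h. openin M U \<and> p \<in> U \<and> metrizes_on atlas D F U h)"

definition affine_ricci_symmetric ::
  "('p, 'n::finite) chart set \<Rightarrow> ('p \<times> ('p, 'n) tvec) set \<Rightarrow> ('p \<times> ('p, 'n) tvec \<Rightarrow> real) \<Rightarrow> bool" where
  "affine_ricci_symmetric atlas D F \<longleftrightarrow>
     (\<forall>c\<in>atlas. \<forall>x\<in>snd c ` fst c. \<forall>i j.
        ricci (affine_connection atlas D F c) i j x = ricci (affine_connection atlas D F c) j i x)"


section \<open>Kropina metrics\<close>

definition kropina_alpha :: "('p, 'n) two_tensor \<Rightarrow> 'p \<times> ('p, 'n) tvec \<Rightarrow> real" where
  "kropina_alpha a = (\<lambda>(p, v). sqrt \<bar>a p v v\<bar>)"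

definition kropina_beta :: "('p, 'n) one_form \<Rightarrow> 'p \<times> ('p, 'n) tvec \<Rightarrow> real" where
  "kropina_beta b = (\<lambda>(p, v). b p v)"

definition kropina :: "real \<Rightarrow> ('p, 'n) two_tensor \<Rightarrow> ('p, 'n) one_form \<Rightarrow> 'p \<times> ('p, 'n) tvec \<Rightarrow> real" where
  "kropina m a b z = kropina_alpha a z powr (1 + m) * kropina_beta b z powr (- m)"

definition m_kropina_metric ::
  "'p topology \<Rightarrow> ('p, 'n::finite) chart set \<Rightarrow> ('p \<times> ('p, 'n) tvec) set \<Rightarrow> real
    \<Rightarrow> ('p, 'n) two_tensor \<Rightarrow> ('p, 'n) one_form \<Rightarrow> ('p \<times> ('p, 'n) tvec \<Rightarrow> real) \<Rightarrow> bool" where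
  "m_kropina_metric M atlas D m a b F \<longleftrightarrow>
     pseudo_riemannian_metric atlas (topspace M) a \<and>
     smooth_one_form atlas (topspace M) b \<and>
     finsler_metric M atlas D F \<and>
     (\<forall>z\<in>D. kropina_alpha a z \<noteq> 0 \<and> kropina_beta b z > 0 \<and> F z = kropina m a b z)"

text \<open>The displayed condition on \<open>f\<close>:
  \<open>\<nabla>\<^sub>j b\<^sub>i = m (f\<^sub>k b\<^sup>k) a\<^sub>i\<^sub>j + b\<^sub>i f\<^sub>j - m f\<^sub>i b\<^sub>j\<close>, with \<open>\<nabla>\<close> the Levi-Civita connection of \<open>a\<close>.\<close>

definition kropina_berwald_equation ::
  "('p, 'n::finite) chart set \<Rightarrow> 'p set \<Rightarrow> real \<Rightarrow> ('p, 'n) two_tensor \<Rightarrow> ('p, 'n) one_form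
    \<Rightarrow> ('p, 'n) vector_field \<Rightarrow> bool" where
  "kropina_berwald_equation atlas U m a b f \<longleftrightarrow>
     (\<forall>c\<in>atlas. \<forall>x\<in>chart_image c U. \<forall>i j.
        cov_deriv atlas c (levi_civita atlas a c) b j i x =
          m * (\<Sum>k\<in>UNIV. form_comp atlas c (lower a f) k x * raised_comp atlas c a b k x)
            * tensor_comp atlas c a i j x
          + form_comp atlas c b i x * form_comp atlas c (lower a f) j x
          - m * form_comp atlas c (lower a f) i x * form_comp atlas c b j x)"

end

theory Submission
  imports Defs
begin

text \<open>In a chart, the equation for \<open>f\<close> says that the torsion-free connection \<open>\<Gamma>\<close> with
  \<open>\<nabla>a = 2mf \<otimes> a\<close> also satisfies \<open>\<nabla>b = (1 + m)f \<otimes> b\<close>. Hence the horizontal derivatives of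
  \<open>L = \<bar>A\<bar>\<^bsup>1+m\<^esup> \<beta>\<^bsup>-2m\<^esup>\<close> with respect to \<open>\<Gamma>\<close> vanish, the two contributions \<open>(1 + m)2mf\<close> and
  \<open>-2m(1 + m)f\<close> to \<open>d ln L\<close> cancelling, so \<open>\<Gamma>\<close> is the affine connection of \<open>F\<close>.

  The antisymmetric part of the Ricci tensor of a torsion-free connection is the exterior derivative
  of the trace \<open>\<Gamma>\<^sup>i\<^sub>i\<^sub>l\<close>. Here this trace is a closed form minus \<open>mnf\<^sub>l\<close>, and \<open>m \<noteq> 0\<close> because \<open>F = \<alpha>\<close> is
  not properly Finslerian; thus Ricci symmetry amounts to closedness of \<open>f\<close>. If locally \<open>f = d\<psi>\<close>,
  the rescaling of \<open>a\<close> by \<open>e\<^bsup>-2m\<psi>\<^esup>\<close> turns \<open>\<Gamma>\<close> into a Levi-Civita connection. Conversely, the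
  Ricci tensor of a Levi-Civita connection is symmetric.\<close>

section \<open>Calculus of smooth maps\<close>

text \<open>The factors of the rescaling are forced. The exponents \<open>- 2 * m\<close> and
  \<open>- (1 + m)\<close> are the negatives of the weights in \<nabla>a = 2mf \<otimes> a and
  \<nabla>b = (1 + m)f \<otimes> b, so that both rescaled tensors become parallel for \<Gamma>. The
  metric F does not change, because \<alpha> is rescaled with weight -m, and -m(1 + m) + m(1 + m) =
  0.

  In the trace of \<Gamma>, the factor n is the contraction of a with its inverse; the other two
  f-terms cancel. The closed form is half the differential of ln |det a|. Its closedness is proved
  for the expression tr (a^-1 da) itself, so that no determinant is differentiated.

  Horizontal derivatives determine the canonical connection through the spray: differentiating the
  horizontal identity in y and contracting with y gives the spray of \<Gamma>, whose y-derivative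
  returns \<Gamma> because \<Gamma> is torsion-free. As \<open>affine_connection\<close> is a
  choice, it has to be identified with \<Gamma> at each point of a chart image; this rests on the
  fibres of the conic subbundle being open and nonempty.\<close>

lemma Ck_on_transform:
  assumes "open S" "Ck_on k S f" "\<And>x. x \<in> S \<Longrightarrow> f x = g x"
  shows "Ck_on k S g"
  using assms(2,3)
proof (induction k arbitrary: f g)
  case 0
  then show ?case using continuous_on_cong[of S S f g] by simp
next
  case (Suc k)
  have d: "f differentiable (at x)" if "x \<in> S" for x
    using Suc.prems(1) that by simp
  have g: "(g has_derivative frechet_derivative f (at x)) (at x)" if "x \<in> S" for x
    by (rule has_derivative_transform_within_open[OF _ assms(1) that Suc.prems(2)])
      (use d[OF that] in \<open>simp_all add: frechet_derivative_works\<close>)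
  have "Ck_on k S (\<lambda>x. frechet_derivative g (at x) v)" for v
  proof (rule Suc.IH)
    show "Ck_on k S (\<lambda>x. frechet_derivative f (at x) v)"
      using Suc.prems(1) by simp
    show "frechet_derivative f (at x) v = frechet_derivative g (at x) v" if "x \<in> S" for x
      using frechet_derivative_at[OF g[OF that]] by simp
  qed
  moreover have "g differentiable (at x)" if "x \<in> S" for x
    using g[OF that] by (rule differentiableI)
  ultimately show ?case by simp
qed

text \<open>Allows an induction on \<open>k\<close> to work with a derivative \<open>f'\<close> in
  closed form. By uniqueness of the derivative, \<open>f'\<close> agrees on \<open>S\<close> with
  the function that \<open>frechet_derivative\<close> chooses, and \<open>Ck_on\<close> on an open
  set depends only on the values there.\<close>

lemma Ck_on_SucI:
  assumes "open S"
    and "\<And>x. x \<in> S \<Longrightarrow> (f has_derivative f' x) (at x)"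
    and "\<And>v. Ck_on k S (\<lambda>x. f' x v)"
  shows "Ck_on (Suc k) S f"
proof -
  have "Ck_on k S (\<lambda>x. frechet_derivative f (at x) v)" for v
    by (rule Ck_on_transform[OF assms(1) assms(3)[of v]])
      (use assms(2) frechet_derivative_at in metis)
  moreover have "f differentiable (at x)" if "x \<in> S" for x
    using assms(2)[OF that] by (rule differentiableI)
  ultimately show ?thesis by simp
qed

lemma Ck_on_subset: "Ck_on k S f \<Longrightarrow> T \<subseteq> S \<Longrightarrow> Ck_on k T f"
  by (induction k arbitrary: f) (auto intro: continuous_on_subset)

text \<open>The recursion for \<open>Suc k\<close> asks for differentiability and for conditions on
  the derivatives, but does not mention \<open>Ck_on k\<close> of \<open>f\<close> itself. The gap
  closes at the bottom, where differentiability gives continuity.\<close>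

lemma Ck_on_SucD: "Ck_on (Suc k) S f \<Longrightarrow> Ck_on k S f"
proof (induction k arbitrary: f)
  case 0
  have "isCont f x" if "x \<in> S" for x
    by (rule differentiable_imp_continuous_within) (use 0 that in simp)
  then show ?case by (simp add: continuous_at_imp_continuous_on)
next
  case (Suc k)
  have "Ck_on k S (\<lambda>x. frechet_derivative f (at x) v)" for v
    by (rule Suc.IH) (use Suc.prems Ck_on.simps(2)[of "Suc k" S f] in blast)
  then show ?case using Suc.prems by simp
qed

lemma Ck_on_const: "Ck_on k S (\<lambda>x. c)"
proof (induction k arbitrary: c)
  case (Suc k)
  then show ?case by simp
qed simp

lemma Ck_on_add:
  assumes "open S" "Ck_on k S f" "Ck_on k S g"
  shows "Ck_on k S (\<lambda>x. f x + g x)"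
  using assms(2,3)
proof (induction k arbitrary: f g)
  case 0
  then show ?case by (simp add: continuous_on_add)
next
  case (Suc k)
  show ?case
  proof (rule Ck_on_SucI[OF assms(1)])
    fix x assume "x \<in> S"
    then show "((\<lambda>x. f x + g x) has_derivative
        (\<lambda>v. frechet_derivative f (at x) v + frechet_derivative g (at x) v)) (at x)"
      using Suc.prems by (auto intro!: has_derivative_add simp: frechet_derivative_works)
  next
    show "Ck_on k S (\<lambda>x. frechet_derivative f (at x) v + frechet_derivative g (at x) v)" for v
      using Suc.prems by (intro Suc.IH) auto
  qed
qed

text \<open>The product rule leaves one factor undifferentiated in each term, and
  \<open>Ck_on_SucD\<close> lowers the order of that factor so that the induction hypothesis applies
  to both terms.\<close>

lemma (in bounded_bilinear) Ck_on:
  assumes "open S" "Ck_on k S f" "Ck_on k S g"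
  shows "Ck_on k S (\<lambda>x. prod (f x) (g x))"
  using assms(2,3)
proof (induction k arbitrary: f g)
  case 0
  then show ?case by (simp add: continuous_on)
next
  case (Suc k)
  show ?case
  proof (rule Ck_on_SucI[OF assms(1)])
    fix x assume "x \<in> S"
    then show "((\<lambda>x. prod (f x) (g x)) has_derivative
        (\<lambda>v. prod (f x) (frechet_derivative g (at x) v) + prod (frechet_derivative f (at x) v) (g x))) (at x)"
      using Suc.prems by (auto intro!: FDERIV simp: frechet_derivative_works)
  next
    show "Ck_on k S (\<lambda>x. prod (f x) (frechet_derivative g (at x) v) +
        prod (frechet_derivative f (at x) v) (g x))" for v
      using Suc.prems Ck_on_SucD[OF Suc.prems(1)] Ck_on_SucD[OF Suc.prems(2)]
      by (intro Ck_on_add assms(1) Suc.IH) auto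
  qed
qed

lemma Ck_on_sum:
  assumes "open S" "\<And>i. i \<in> I \<Longrightarrow> Ck_on k S (f i)"
  shows "Ck_on k S (\<lambda>x. \<Sum>i\<in>I. f i x)"
  using assms(2)
  by (induction I rule: infinite_finite_induct) (auto intro: Ck_on_const Ck_on_add assms(1))

lemma Ck_on_compose_bounded_linear:
  assumes "bounded_linear h" "open S" "Ck_on k S f"
  shows "Ck_on k S (\<lambda>x. h (f x))"
  using assms(3)
proof (induction k arbitrary: f)
  case 0
  then show ?case using assms(1) by (simp add: bounded_linear.continuous_on)
next
  case (Suc k)
  show ?case
  proof (rule Ck_on_SucI[OF assms(2)])
    fix x assume "x \<in> S"
    then show "((\<lambda>x. h (f x)) has_derivative (\<lambda>v. h (frechet_derivative f (at x) v))) (at x)"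
      using Suc.prems bounded_linear.has_derivative[OF assms(1)]
      by (auto simp: frechet_derivative_works)
  next
    show "Ck_on k S (\<lambda>x. h (frechet_derivative f (at x) v))" for v
      using Suc.prems by (intro Suc.IH) auto
  qed
qed

text \<open>In the chain rule the derivative of \<open>g\<close> is taken in a direction that varies
  with \<open>x\<close>, whereas \<open>Ck_on\<close> speaks of fixed directions only. Expanding the
  direction in an orthonormal basis of the Euclidean space \<open>'b\<close> leaves derivatives of
  \<open>g\<close> in basis directions with C^k coefficients.\<close>

lemma Ck_on_compose:
  fixes f :: "'a::real_normed_vector \<Rightarrow> 'b::euclidean_space"
  assumes "open S" "open T" "f ` S \<subseteq> T" "Ck_on k S f" "Ck_on k T g"
  shows "Ck_on k S (\<lambda>x. g (f x))"
  using assms(4,5)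
proof (induction k arbitrary: g)
  case 0
  then show ?case using assms(3) continuous_on_compose2[of T g S f] by simp
next
  case (Suc k)
  have fx: "f x \<in> T" if "x \<in> S" for x using assms(3) that by auto
  have dg: "(g has_derivative frechet_derivative g (at (f x))) (at (f x))" if "x \<in> S" for x
    using Suc.prems fx[OF that] by (auto simp: frechet_derivative_works)
  show ?case
  proof (rule Ck_on_SucI[OF assms(1)])
    fix x assume x: "x \<in> S"
    let ?f' = "frechet_derivative f (at x)"
    have "(f has_derivative ?f') (at x)"
      using Suc.prems x by (auto simp: frechet_derivative_works)
    then have "((\<lambda>x. g (f x)) has_derivative (\<lambda>v. frechet_derivative g (at (f x)) (?f' v))) (at x)"
      using dg[OF x] by (rule has_derivative_compose)
    moreover have "frechet_derivative g (at (f x)) (?f' v) =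
        (\<Sum>i\<in>Basis. (?f' v \<bullet> i) *\<^sub>R frechet_derivative g (at (f x)) i)" for v
    proof -
      interpret G: linear "frechet_derivative g (at (f x))"
        using dg[OF x] has_derivative_linear by blast
      have "(\<Sum>i\<in>Basis. (?f' v \<bullet> i) *\<^sub>R frechet_derivative g (at (f x)) i) =
          frechet_derivative g (at (f x)) (\<Sum>i\<in>Basis. (?f' v \<bullet> i) *\<^sub>R i)"
        unfolding G.sum G.scale ..
      then show ?thesis unfolding euclidean_representation by (rule sym)
    qed
    ultimately show "((\<lambda>x. g (f x)) has_derivative
        (\<lambda>v. \<Sum>i\<in>Basis. (?f' v \<bullet> i) *\<^sub>R frechet_derivative g (at (f x)) i)) (at x)"
      by simp
  next
    fix v
    show "Ck_on k S (\<lambda>x. \<Sum>i\<in>Basis. (frechet_derivative f (at x) v \<bullet> i) *\<^sub>R frechet_derivative g (at (f x)) i)"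
    proof (intro Ck_on_sum assms(1) bounded_bilinear.Ck_on[OF bounded_bilinear_scaleR])
      show "Ck_on k S (\<lambda>x. frechet_derivative f (at x) v \<bullet> i)" for i
        using Suc.prems(1) by (intro Ck_on_compose_bounded_linear[OF bounded_linear_inner_left assms(1)]) auto
      show "Ck_on k S (\<lambda>x. frechet_derivative g (at (f x)) i)" for i
        using Suc.prems Ck_on_SucD[OF Suc.prems(1)] by (intro Suc.IH) auto
    qed
  qed
qed

lemma Ck_on_exp: "Ck_on k UNIV (exp :: real \<Rightarrow> real)"
proof (induction k)
  case (Suc k)
  show ?case
    by (rule Ck_on_SucI[where f' = "\<lambda>x v. v * exp x"])
      (auto intro!: derivative_eq_intros bounded_bilinear.Ck_on[OF bounded_bilinear_mult]
        Ck_on_const Suc)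
qed (simp add: continuous_on_exp)

text \<open>The derivative of \<open>inverse\<close> is a multiple of
  \<open>inverse x * inverse x\<close>, hence a product of functions already covered by the
  induction hypothesis.\<close>

lemma Ck_on_inverse: "Ck_on k (- {0}) (inverse :: real \<Rightarrow> real)"
proof (induction k)
  case (Suc k)
  have "Ck_on k (- {0::real}) (\<lambda>x. (- v) * (inverse x * inverse x))" for v :: real
    by (intro bounded_bilinear.Ck_on[OF bounded_bilinear_mult] Ck_on_const Suc) auto
  moreover have "(inverse has_derivative (\<lambda>v. (- v) * (inverse x * inverse x))) (at x)"
    if "x \<in> - {0}" for x :: real
    using that by (auto intro!: derivative_eq_intros simp: mult_ac)
  ultimately show ?case
    by (intro Ck_on_SucI[where f' = "\<lambda>x v. (- v) * (inverse x * inverse x)"]) auto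
qed (auto intro: continuous_on_inverse)

section \<open>Closure properties of smooth functions\<close>

lemma smooth_on_transform:
  "open S \<Longrightarrow> smooth_on S f \<Longrightarrow> (\<And>x. x \<in> S \<Longrightarrow> f x = g x) \<Longrightarrow> smooth_on S g"
  using Ck_on_transform unfolding smooth_on_def by blast

lemma smooth_on_subset: "smooth_on S f \<Longrightarrow> T \<subseteq> S \<Longrightarrow> smooth_on T f"
  using Ck_on_subset unfolding smooth_on_def by blast

lemma smooth_on_const: "smooth_on S (\<lambda>x. c)"
  by (simp add: smooth_on_def Ck_on_const)

lemma smooth_on_add:
  "open S \<Longrightarrow> smooth_on S f \<Longrightarrow> smooth_on S g \<Longrightarrow> smooth_on S (\<lambda>x. f x + g x)"
  by (simp add: smooth_on_def Ck_on_add)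

lemma smooth_on_mult:
  fixes f g :: "'a::real_normed_vector \<Rightarrow> real"
  shows "open S \<Longrightarrow> smooth_on S f \<Longrightarrow> smooth_on S g \<Longrightarrow> smooth_on S (\<lambda>x. f x * g x)"
  by (simp add: smooth_on_def bounded_bilinear.Ck_on[OF bounded_bilinear_mult])

lemma smooth_on_diff:
  fixes f g :: "'a::real_normed_vector \<Rightarrow> real"
  shows "open S \<Longrightarrow> smooth_on S f \<Longrightarrow> smooth_on S g \<Longrightarrow> smooth_on S (\<lambda>x. f x - g x)"
  using smooth_on_add[of S f "\<lambda>x. (-1) * g x"] smooth_on_mult[OF _ smooth_on_const, of S g "-1"]
  by simp

lemma smooth_on_sum:
  "open S \<Longrightarrow> (\<And>i. i \<in> I \<Longrightarrow> smooth_on S (f i)) \<Longrightarrow> smooth_on S (\<lambda>x. \<Sum>i\<in>I. f i x)"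
  by (simp add: smooth_on_def Ck_on_sum)

lemma smooth_on_prod:
  fixes f :: "'i \<Rightarrow> 'a::real_normed_vector \<Rightarrow> real"
  shows "open S \<Longrightarrow> (\<And>i. i \<in> I \<Longrightarrow> smooth_on S (f i)) \<Longrightarrow> smooth_on S (\<lambda>x. \<Prod>i\<in>I. f i x)"
  by (induction I rule: infinite_finite_induct) (auto intro: smooth_on_const smooth_on_mult)

lemma smooth_on_compose_bounded_linear:
  "bounded_linear h \<Longrightarrow> open S \<Longrightarrow> smooth_on S f \<Longrightarrow> smooth_on S (\<lambda>x. h (f x))"
  by (simp add: smooth_on_def Ck_on_compose_bounded_linear)

lemma smooth_on_compose:
  fixes f :: "'a::real_normed_vector \<Rightarrow> 'b::euclidean_space"
  assumes "open S" "open T" "f ` S \<subseteq> T" "smooth_on S f" "smooth_on T g"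
  shows "smooth_on S (\<lambda>x. g (f x))"
  using assms Ck_on_compose unfolding smooth_on_def by blast

lemma smooth_on_exp:
  "open S \<Longrightarrow> smooth_on S f \<Longrightarrow> smooth_on S (\<lambda>x. exp (f x :: real))"
  using smooth_on_compose[of S UNIV f exp] Ck_on_exp by (auto simp: smooth_on_def)

lemma smooth_on_divide:
  fixes f g :: "'a::real_normed_vector \<Rightarrow> real"
  assumes "open S" "smooth_on S f" "smooth_on S g" "\<And>x. x \<in> S \<Longrightarrow> g x \<noteq> 0"
  shows "smooth_on S (\<lambda>x. f x / g x)"
proof -
  have "smooth_on S (\<lambda>x. inverse (g x))"
    by (rule smooth_on_compose[of S "- {0}"]) (use assms Ck_on_inverse in \<open>auto simp: smooth_on_def\<close>)
  then show ?thesis using smooth_on_mult[OF assms(1,2)] by (simp add: divide_inverse)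
qed

lemma smooth_on_derivative:
  "smooth_on S f \<Longrightarrow> smooth_on S (\<lambda>x. frechet_derivative f (at x) v)"
  unfolding smooth_on_def using Ck_on.simps(2)[of _ S f] by blast

lemma smooth_on_has_derivative:
  "smooth_on S f \<Longrightarrow> x \<in> S \<Longrightarrow> (f has_derivative frechet_derivative f (at x)) (at x)"
  unfolding smooth_on_def frechet_derivative_works[symmetric] using Ck_on.simps(2)[of _ S f] by blast

lemma smooth_on_continuous: "smooth_on S f \<Longrightarrow> continuous_on S f"
  unfolding smooth_on_def by (metis Ck_on.simps(1))

lemma smooth_onI:
  assumes "open S" "\<And>x. x \<in> S \<Longrightarrow> (f has_derivative f' x) (at x)"
    and "\<And>v. smooth_on S (\<lambda>x. f' x v)"
  shows "smooth_on S f"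
proof -
  have "Ck_on (Suc k) S f" for k
    using assms Ck_on_SucI unfolding smooth_on_def by blast
  then show ?thesis using Ck_on_SucD unfolding smooth_on_def by blast
qed

lemma smooth_on_partial: "smooth_on S f \<Longrightarrow> smooth_on S (partial i f)"
  using smooth_on_derivative[of S f "axis i 1"] unfolding partial_def[abs_def] .

lemma smooth_on_differentiable: "smooth_on S f \<Longrightarrow> x \<in> S \<Longrightarrow> f differentiable (at x)"
  using smooth_on_has_derivative differentiableI by blast

section \<open>Rules for partial derivatives\<close>

lemma has_derivative_imp_partial:
  "(h has_derivative h') (at x) \<Longrightarrow> partial i h x = h' (axis i 1)"
  unfolding partial_def by (metis frechet_derivative_at)

text \<open>Functions that agree near \<open>x\<close> have the same derivatives at
  \<open>x\<close>, and \<open>frechet_derivative\<close> chooses among them. The chosen values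
  therefore coincide even at points where no derivative exists.\<close>

lemma frechet_derivative_cong:
  assumes "open S" "x \<in> S" "\<And>y. y \<in> S \<Longrightarrow> f y = g y"
  shows "frechet_derivative f (at x) = frechet_derivative g (at x)"
proof -
  have "(f has_derivative f') (at x) \<longleftrightarrow> (g has_derivative f') (at x)" for f'
    by (intro iffI; erule has_derivative_transform_within_open[OF _ assms(1,2)]) (simp_all add: assms(3))
  then show ?thesis unfolding frechet_derivative_def by simp
qed

lemma partial_cong:
  assumes "open S" "x \<in> S" "\<And>y. y \<in> S \<Longrightarrow> f y = g y"
  shows "partial i f x = partial i g x"
  unfolding partial_def using frechet_derivative_cong[of S x f g] assms by simp

lemma partial_const [simp]: "partial i (\<lambda>x. c) x = 0"
  by (simp add: partial_def)

lemma frechet_derivative_diff: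
  assumes "f differentiable (at x)" "g differentiable (at x)"
  shows "frechet_derivative (\<lambda>x. f x - g x) (at x) v =
    frechet_derivative f (at x) v - frechet_derivative g (at x) v"
  using frechet_derivative_at[OF has_derivative_diff[OF assms[unfolded frechet_derivative_works]], symmetric]
  by simp

lemma frechet_derivative_mult:
  fixes f g :: "'a::real_normed_vector \<Rightarrow> real"
  assumes "f differentiable (at x)" "g differentiable (at x)"
  shows "frechet_derivative (\<lambda>x. f x * g x) (at x) v =
    f x * frechet_derivative g (at x) v + frechet_derivative f (at x) v * g x"
  using frechet_derivative_at[OF has_derivative_mult[OF assms[unfolded frechet_derivative_works]], symmetric]
  by simp

lemma frechet_derivative_sum:
  assumes "\<And>j. j \<in> J \<Longrightarrow> f j differentiable (at x)"
  shows "frechet_derivative (\<lambda>x. \<Sum>j\<in>J. f j x) (at x) v = (\<Sum>j\<in>J. frechet_derivative (f j) (at x) v)"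
proof -
  have "((\<lambda>x. \<Sum>j\<in>J. f j x) has_derivative (\<lambda>v. \<Sum>j\<in>J. frechet_derivative (f j) (at x) v)) (at x)"
    using assms by (intro has_derivative_sum) (simp add: frechet_derivative_works)
  from frechet_derivative_at[OF this, symmetric] show ?thesis by simp
qed

lemma partial_diff:
  assumes "f differentiable (at x)" "g differentiable (at x)"
  shows "partial i (\<lambda>x. f x - g x) x = partial i f x - partial i g x"
  unfolding partial_def by (rule frechet_derivative_diff[OF assms])

lemma partial_mult:
  assumes "f differentiable (at x)" "g differentiable (at x)"
  shows "partial i (\<lambda>x. f x * g x) x = f x * partial i g x + partial i f x * g x"
  unfolding partial_def by (rule frechet_derivative_mult[OF assms])

lemma partial_sum:
  assumes "\<And>j. j \<in> J \<Longrightarrow> f j differentiable (at x)"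
  shows "partial i (\<lambda>x. \<Sum>j\<in>J. f j x) x = (\<Sum>j\<in>J. partial i (f j) x)"
  unfolding partial_def by (rule frechet_derivative_sum[OF assms])

lemma partial_cmult:
  assumes "g differentiable (at x)"
  shows "partial i (\<lambda>x. c * g x) x = c * partial i g x"
  using partial_mult[OF differentiable_const[of c] assms] by simp

lemma linear_sum_axis:
  fixes h :: "real ^ 'n::finite \<Rightarrow> real"
  assumes "linear h"
  shows "h v = (\<Sum>i\<in>UNIV. v $ i * h (axis i 1))"
proof -
  interpret linear h by fact
  have "(\<Sum>i\<in>UNIV. v $ i * h (axis i 1)) = h (\<Sum>i\<in>UNIV. v $ i *\<^sub>R axis i 1)"
    unfolding sum scale by simp
  also have "(\<Sum>i\<in>UNIV. v $ i *\<^sub>R axis i 1) = v"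
    using basis_expansion[of v] by (simp add: scalar_mult_eq_scaleR)
  finally show ?thesis ..
qed

lemma frechet_derivative_eq_partial:
  assumes "f differentiable (at x)"
  shows "frechet_derivative f (at x) v = (\<Sum>i\<in>UNIV. v $ i * partial i f x)"
  unfolding partial_def by (rule linear_sum_axis[OF linear_frechet_derivative[OF assms]])

section \<open>Symmetry of second derivatives\<close>

lemma has_real_derivative_along_line:
  assumes "(f has_derivative f') (at (x + s *\<^sub>R u))"
  shows "((\<lambda>s. f (x + s *\<^sub>R u)) has_real_derivative f' u) (at s)"
proof -
  have "((\<lambda>s. x + s *\<^sub>R u) has_derivative (\<lambda>s. s *\<^sub>R u)) (at s)"
    by (auto intro!: derivative_eq_intros)
  from has_derivative_compose[OF this assms]
  have "((\<lambda>s. f (x + s *\<^sub>R u)) has_derivative (\<lambda>s. f' (s *\<^sub>R u))) (at s)" .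
  moreover have "f' (s *\<^sub>R u) = f' u * s" for s
    using has_derivative_linear[OF assms] by (simp add: linear_cmul)
  ultimately show ?thesis by (simp add: has_field_derivative_def)
qed

text \<open>Two applications of the mean value theorem, one along \<open>u\<close> and one along
  \<open>v\<close>, turn the quotient into a value of \<open>W\<close> at a point near
  \<open>x\<close>; continuity of \<open>W\<close> does the rest. The point of the quotient is that
  it is symmetric in \<open>u\<close> and \<open>v\<close>.\<close>

lemma second_difference_tendsto:
  fixes f :: "'a::real_normed_vector \<Rightarrow> real" and u v :: 'a
  assumes S: "open S" "x \<in> S" and f: "smooth_on S f"
  defines "W \<equiv> \<lambda>y. frechet_derivative (\<lambda>z. frechet_derivative f (at z) u) (at y) v"
  shows "((\<lambda>h. (f (x + h *\<^sub>R u + h *\<^sub>R v) - f (x + h *\<^sub>R u) - f (x + h *\<^sub>R v) + f x) / (h * h))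
    \<longlongrightarrow> W x) (at_right 0)"
proof (rule tendstoI)
  fix e :: real assume "0 < e"
  have "smooth_on S W"
    unfolding W_def by (intro smooth_on_derivative f)
  then have "isCont W x"
    using smooth_on_differentiable S(2) differentiable_imp_continuous_within by blast
  then obtain r1 where r1: "r1 > 0" "\<And>y. dist y x < r1 \<Longrightarrow> dist (W y) (W x) < e"
    using \<open>0 < e\<close> unfolding continuous_at_eps_delta by blast
  obtain r2 where r2: "r2 > 0" "ball x r2 \<subseteq> S"
    using S openE by blast
  define r where "r = min r1 r2"
  \<comment> \<open>With this bound the parallelogram spanned by \<open>h *\<^sub>R u\<close> and
    \<open>h *\<^sub>R v\<close> stays within distance \<open>r\<close> of \<open>x\<close>; the
    summand 1 keeps the denominator positive when both vectors are 0.\<close>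
  define d where "d = r / (norm u + norm v + 1)"
  have "d > 0" using r1 r2 by (auto simp: d_def r_def intro!: divide_pos_pos add_nonneg_pos)
  have near: "dist (x + s *\<^sub>R u + t *\<^sub>R v) x < r" if "0 \<le> s" "s \<le> h" "0 \<le> t" "t \<le> h" "h < d" for s t h
  proof -
    have "dist (x + s *\<^sub>R u + t *\<^sub>R v) x = norm (s *\<^sub>R u + t *\<^sub>R v)"
      by (simp add: dist_norm algebra_simps)
    also have "\<dots> \<le> s * norm u + t * norm v"
      using norm_triangle_ineq[of "s *\<^sub>R u" "t *\<^sub>R v"] that by simp
    also have "\<dots> \<le> h * norm u + h * norm v"
      using that by (intro add_mono mult_right_mono) auto
    also have "\<dots> \<le> h * (norm u + norm v + 1)"
      using that by (simp add: algebra_simps)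
    also have "\<dots> < d * (norm u + norm v + 1)"
      using that by (intro mult_strict_right_mono add_nonneg_pos) auto
    also have "d * (norm u + norm v + 1) = r"
      unfolding d_def using add_nonneg_pos[of "norm u + norm v" 1] by simp
    finally show ?thesis .
  qed
  have inS: "y \<in> S" if "dist y x < r" for y
    using r2 that by (auto simp: r_def dist_commute)
  have "dist ((f (x + h *\<^sub>R u + h *\<^sub>R v) - f (x + h *\<^sub>R u) - f (x + h *\<^sub>R v) + f x) / (h * h)) (W x) < e"
    if h: "0 < h" "h < d" for h
  proof -
    \<comment> \<open>The second difference is an increment of \<open>\<phi>\<close> over
      \<open>[0, h]\<close>: the step in direction \<open>v\<close> is built into
      \<open>\<phi>\<close>, the step in direction \<open>u\<close> is the variable.\<close>
    define \<phi> where "\<phi> = (\<lambda>s. f (x + h *\<^sub>R v + s *\<^sub>R u) - f (x + s *\<^sub>R u))"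
    define \<phi>' where "\<phi>' = (\<lambda>s. frechet_derivative f (at (x + h *\<^sub>R v + s *\<^sub>R u)) u
      - frechet_derivative f (at (x + s *\<^sub>R u)) u)"
    have "(\<phi> has_real_derivative \<phi>' s) (at s)" if "0 \<le> s" "s \<le> h" for s
    proof -
      have "x + h *\<^sub>R v + s *\<^sub>R u \<in> S" "x + s *\<^sub>R u \<in> S"
        using inS[OF near[of s h h]] inS[OF near[of s h 0]] h that by (simp_all add: add_ac)
      then show ?thesis unfolding \<phi>_def \<phi>'_def
        by (intro DERIV_diff has_real_derivative_along_line smooth_on_has_derivative[OF f])
    qed
    from MVT2[OF h(1) this] obtain s where s: "0 < s" "s < h" "\<phi> h - \<phi> 0 = (h - 0) * \<phi>' s"
      by auto
    \<comment> \<open>At the intermediate \<open>s\<close>, the value \<open>\<phi>' s\<close> is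
      itself an increment, now along \<open>v\<close>, of the derivative in direction
      \<open>u\<close>.\<close>
    define \<eta> where "\<eta> = (\<lambda>t. frechet_derivative f (at (x + s *\<^sub>R u + t *\<^sub>R v)) u)"
    have "(\<eta> has_real_derivative W (x + s *\<^sub>R u + t *\<^sub>R v)) (at t)" if "0 \<le> t" "t \<le> h" for t
      unfolding \<eta>_def W_def
      using inS[OF near[of s h t]] h s that
      by (intro has_real_derivative_along_line smooth_on_has_derivative[of S] smooth_on_derivative f) auto
    from MVT2[OF h(1) this] obtain t where t: "0 < t" "t < h"
      "\<eta> h - \<eta> 0 = (h - 0) * W (x + s *\<^sub>R u + t *\<^sub>R v)"
      by auto
    have "\<phi>' s = \<eta> h - \<eta> 0" by (simp add: \<phi>'_def \<eta>_def add_ac)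
    then have "\<phi> h - \<phi> 0 = (h * h) * W (x + s *\<^sub>R u + t *\<^sub>R v)"
      using s t by simp
    moreover have "f (x + h *\<^sub>R u + h *\<^sub>R v) - f (x + h *\<^sub>R u) - f (x + h *\<^sub>R v) + f x = \<phi> h - \<phi> 0"
      by (simp add: \<phi>_def add_ac)
    ultimately have "(f (x + h *\<^sub>R u + h *\<^sub>R v) - f (x + h *\<^sub>R u) - f (x + h *\<^sub>R v) + f x) / (h * h)
        = W (x + s *\<^sub>R u + t *\<^sub>R v)"
      using h by simp
    then show ?thesis using near[of s h t] s t h r1(2) by (simp add: r_def)
  qed
  then show "\<forall>\<^sub>F h in at_right 0. dist ((f (x + h *\<^sub>R u + h *\<^sub>R v) - f (x + h *\<^sub>R u) -
      f (x + h *\<^sub>R v) + f x) / (h * h)) (W x) < e"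
    using \<open>d > 0\<close> unfolding eventually_at_right_field by blast
qed

text \<open>Both mixed derivatives are limits of one and the same quotient, because exchanging
  \<open>u\<close> and \<open>v\<close> only exchanges its two middle terms.\<close>

lemma second_derivative_symmetric:
  fixes f :: "'a::real_normed_vector \<Rightarrow> real"
  assumes S: "open S" "x \<in> S" and f: "smooth_on S f"
  shows "frechet_derivative (\<lambda>z. frechet_derivative f (at z) u) (at x) v =
    frechet_derivative (\<lambda>z. frechet_derivative f (at z) v) (at x) u"
proof (rule tendsto_unique[OF _ second_difference_tendsto[OF assms]])
  have "(\<lambda>h. f (x + h *\<^sub>R v + h *\<^sub>R u) - f (x + h *\<^sub>R v) - f (x + h *\<^sub>R u) + f x) =
      (\<lambda>h. f (x + h *\<^sub>R u + h *\<^sub>R v) - f (x + h *\<^sub>R u) - f (x + h *\<^sub>R v) + f x)"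
    by (simp add: add_ac fun_eq_iff)
  note eq = fun_cong[OF this]
  show "((\<lambda>h. (f (x + h *\<^sub>R u + h *\<^sub>R v) - f (x + h *\<^sub>R u) - f (x + h *\<^sub>R v) + f x) / (h * h))
    \<longlongrightarrow> frechet_derivative (\<lambda>z. frechet_derivative f (at z) v) (at x) u) (at_right 0)"
    using second_difference_tendsto[OF assms, of v u] unfolding eq .
qed simp

lemma partial_commute:
  assumes "open S" "x \<in> S" "smooth_on S f"
  shows "partial i (partial j f) x = partial j (partial i f) x"
  using second_derivative_symmetric[OF assms, of "axis j 1" "axis i 1"]
  unfolding partial_def[abs_def] .

text \<open>The potential is the integral of the form along the segment from the centre.
  Differentiating under the integral gives an integrand which, for a closed form, is the derivative
  in \<open>t\<close> of \<open>t * w k (p x t)\<close> summed against \<open>v\<close>.\<close>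

lemma Poincare_lemma_ball:
  fixes w :: "'n::finite \<Rightarrow> real ^ 'n \<Rightarrow> real"
  assumes w: "\<And>i. smooth_on (ball x0 r) (w i)"
    and closed: "\<And>i j x. x \<in> ball x0 r \<Longrightarrow> partial i (w j) x = partial j (w i) x"
  shows "\<exists>\<psi>. smooth_on (ball x0 r) \<psi> \<and>
    (\<forall>x\<in>ball x0 r. (\<psi> has_derivative (\<lambda>v. \<Sum>k\<in>UNIV. v $ k * w k x)) (at x))"
proof -
  define p where "p = (\<lambda>x t. x0 + t *\<^sub>R (x - x0))"
  define \<psi> where "\<psi> = (\<lambda>x. integral (cbox 0 1) (\<lambda>t. \<Sum>i\<in>UNIV. w i (p x t) * (x - x0) $ i))"
  define g where "g = (\<lambda>x t v. \<Sum>i\<in>UNIV. w i (p x t) * v $ i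
    + frechet_derivative (w i) (at (p x t)) (t *\<^sub>R v) * (x - x0) $ i)"
  have p: "p x t \<in> ball x0 r" if "x \<in> ball x0 r" "t \<in> cbox 0 1" for x t
  proof -
    have "norm (t *\<^sub>R (x - x0)) \<le> 1 * norm (x - x0)"
      unfolding norm_scaleR using that by (intro mult_right_mono) auto
    then show ?thesis using that by (simp add: p_def dist_norm norm_minus_commute)
  qed
  have dg: "((\<lambda>x. \<Sum>i\<in>UNIV. w i (p x t) * (x - x0) $ i) has_derivative g x t) (at x)"
    if "x \<in> ball x0 r" "t \<in> cbox 0 1" for x t
  proof -
    have "((\<lambda>x. p x t) has_derivative (\<lambda>v. t *\<^sub>R v)) (at x)"
      unfolding p_def by (auto intro!: derivative_eq_intros)
    from has_derivative_compose[OF this smooth_on_has_derivative[OF w p[OF that]]]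
    have 1: "((\<lambda>x. w i (p x t)) has_derivative (\<lambda>v. frechet_derivative (w i) (at (p x t)) (t *\<^sub>R v))) (at x)"
      for i .
    have 2: "((\<lambda>x. (x - x0) $ i) has_derivative (\<lambda>v. v $ i)) (at x)" for i
      by (auto intro!: derivative_eq_intros bounded_linear.has_derivative[OF bounded_linear_vec_nth])
    show ?thesis unfolding g_def
      by (intro has_derivative_sum has_derivative_mult 1 2)
  qed
  have bl: "bounded_linear (g x t)" if "x \<in> ball x0 r" "t \<in> cbox 0 1" for x t
    using dg[OF that] by (rule has_derivative_bounded_linear)
  have contp: "continuous_on (ball x0 r \<times> cbox 0 1) (\<lambda>(x, t). p x t)"
    unfolding p_def case_prod_unfold by (intro continuous_intros)
  have contw: "continuous_on (ball x0 r \<times> cbox 0 1) (\<lambda>(x, t). h (p x t))"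
    if "smooth_on (ball x0 r) h" for h :: "real ^ 'n \<Rightarrow> real"
  proof -
    have "(\<lambda>(x, t). p x t) ` (ball x0 r \<times> cbox 0 1) \<subseteq> ball x0 r"
      unfolding image_subset_iff using p by (auto simp del: mem_ball)
    from continuous_on_compose2[OF smooth_on_continuous[OF that] contp this]
    show ?thesis by (simp add: case_prod_unfold)
  qed
  have contg: "continuous_on (ball x0 r \<times> cbox 0 1) (\<lambda>(x, t). g x t v)" for v
  proof -
    have "g x t v = (\<Sum>i\<in>UNIV. w i (p x t) * v $ i
      + t * frechet_derivative (w i) (at (p x t)) v * (x - x0) $ i)"
      if "x \<in> ball x0 r" "t \<in> cbox 0 1" for x t
    proof -
      have "frechet_derivative (w i) (at (p x t)) (t *\<^sub>R v) =
          t *\<^sub>R frechet_derivative (w i) (at (p x t)) v" for i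
        by (rule linear_cmul[OF linear_frechet_derivative[OF smooth_on_differentiable[OF w p[OF that]]]])
      then show ?thesis by (simp add: g_def)
    qed
    moreover have "continuous_on (ball x0 r \<times> cbox 0 1) (\<lambda>(x, t). \<Sum>i\<in>UNIV. w i (p x t) * v $ i
      + t * frechet_derivative (w i) (at (p x t)) v * (x - x0) $ i)"
      using contw[OF w] contw[OF smooth_on_derivative[OF w]]
      unfolding case_prod_unfold
      by (intro continuous_intros) auto
    ultimately show ?thesis
      by (subst continuous_on_cong[OF refl, where g = "\<lambda>(x, t). \<Sum>i\<in>UNIV. w i (p x t) * v $ i
      + t * frechet_derivative (w i) (at (p x t)) v * (x - x0) $ i"]) auto
  qed
  \<comment> \<open>Differentiation under the integral needs the derivative as a continuous function
    with values in the bounded linear maps. It is integrated in that space and evaluated at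
    \<open>v\<close> only afterwards.\<close>
  define G where "G = (\<lambda>x t. Blinfun (g x t))"
  have G: "blinfun_apply (G x t) = g x t" if "x \<in> ball x0 r" "t \<in> cbox 0 1" for x t
    using bl[OF that] by (simp add: G_def bounded_linear_Blinfun_apply)
  have contG: "continuous_on (ball x0 r \<times> cbox 0 1) (\<lambda>(x, t). G x t)"
  proof (rule continuous_on_blinfun_componentwise)
    fix v :: "real ^ 'n" 
    show "continuous_on (ball x0 r \<times> cbox 0 1) (\<lambda>z. blinfun_apply (case z of (x, t) \<Rightarrow> G x t) v)"
      by (subst continuous_on_cong[OF refl, where g = "\<lambda>(x, t). g x t v"]) (use G contg in auto)
  qed
  have Pair_x: "continuous_on (cbox 0 1) (\<lambda>t. (x, t))"
    "(\<lambda>t. (x, t)) ` cbox 0 1 \<subseteq> ball x0 r \<times> cbox 0 1"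
    if "x \<in> ball x0 r" for x
    by (intro continuous_intros) (use that in auto)
  have contwi: "continuous_on (cbox 0 1) (\<lambda>t. h (p x t))" if "smooth_on (ball x0 r) h" "x \<in> ball x0 r"
    for h :: "real ^ 'n \<Rightarrow> real" and x
    using continuous_on_compose2[OF contw[OF that(1)] Pair_x[OF that(2)]] by simp
  have int: "(\<lambda>t. \<Sum>i\<in>UNIV. w i (p x t) * (x - x0) $ i) integrable_on cbox 0 1" if "x \<in> ball x0 r" for x
    by (intro integrable_continuous continuous_intros contwi w that)
  have eval: "blinfun_apply (integral (cbox 0 1) (G x)) v = (\<Sum>k\<in>UNIV. v $ k * w k x)"
    if x: "x \<in> ball x0 r" for x v
  proof -
    have "continuous_on (cbox 0 1) (G x)"
      using continuous_on_compose2[OF contG Pair_x[OF x]] by simp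
    then have "G x integrable_on cbox 0 1" by (rule integrable_continuous)
    from integral_linear[OF this bounded_bilinear.bounded_linear_left[OF bounded_bilinear_blinfun_apply], of v]
    have "blinfun_apply (integral (cbox 0 1) (G x)) v = integral (cbox 0 1) (\<lambda>t. blinfun_apply (G x t) v)"
      by (simp add: o_def)
    also have "\<dots> = integral (cbox 0 1) (\<lambda>t. g x t v)"
      by (intro integral_cong) (use G[OF x] in simp)
    \<comment> \<open>The factors 1 and 0 are the end values of \<open>t\<close> in the primitive;
      the lower one makes the contribution of the centre disappear.\<close>
    also have "\<dots> = (\<Sum>k\<in>UNIV. v $ k * (1 * w k (p x 1))) - (\<Sum>k\<in>UNIV. v $ k * (0 * w k (p x 0)))"
    proof (rule integral_unique, unfold cbox_interval, rule fundamental_theorem_of_calculus)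
      fix t :: real assume "t \<in> {0..1}"
      then have t: "t \<in> cbox 0 1" by simp
      note diff = smooth_on_differentiable[OF w p[OF x t]]
      have D: "((\<lambda>t. w k (p x t)) has_real_derivative frechet_derivative (w k) (at (p x t)) (x - x0)) (at t)" for k
        using has_real_derivative_along_line[of "w k" _ x0 t "x - x0"]
          smooth_on_has_derivative[OF w p[OF x t], of k]
        unfolding p_def by blast
      have "((\<lambda>t. \<Sum>k\<in>UNIV. v $ k * (t * w k (p x t))) has_real_derivative
          (\<Sum>k\<in>UNIV. v $ k * (w k (p x t) + t * frechet_derivative (w k) (at (p x t)) (x - x0)))) (at t)"
        by (auto intro!: derivative_eq_intros D simp: algebra_simps)
      moreover have "(\<Sum>k\<in>UNIV. v $ k * (w k (p x t) + t * frechet_derivative (w k) (at (p x t)) (x - x0)))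
          = g x t v"
      proof -
        have "(\<Sum>k\<in>UNIV. v $ k * (t * frechet_derivative (w k) (at (p x t)) (x - x0)))
          = (\<Sum>k\<in>UNIV. \<Sum>i\<in>UNIV. t * v $ k * (x - x0) $ i * partial i (w k) (p x t))"
          unfolding frechet_derivative_eq_partial[OF diff] by (simp add: sum_distrib_left mult_ac)
        \<comment> \<open>Closedness enters here: exchanging the indices turns the radial derivative
          of \<open>w k\<close> into the derivative of the integrand in direction
          \<open>v\<close>.\<close>
        also have "\<dots> = (\<Sum>k\<in>UNIV. \<Sum>i\<in>UNIV. t * v $ k * (x - x0) $ i * partial k (w i) (p x t))"
          using closed[OF p[OF x t]] by simp
        also have "\<dots> = (\<Sum>i\<in>UNIV. \<Sum>k\<in>UNIV. t * v $ k * (x - x0) $ i * partial k (w i) (p x t))"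
          by (rule sum.swap)
        also have "\<dots> = (\<Sum>i\<in>UNIV. frechet_derivative (w i) (at (p x t)) (t *\<^sub>R v) * (x - x0) $ i)"
          unfolding frechet_derivative_eq_partial[OF diff] by (simp add: sum_distrib_left sum_distrib_right mult_ac)
        finally show ?thesis
          by (simp add: g_def distrib_left sum.distrib mult.commute)
      qed
      ultimately show "((\<lambda>t. \<Sum>k\<in>UNIV. v $ k * (t * w k (p x t))) has_vector_derivative g x t v) (at t within {0..1})"
        by (simp add: has_real_derivative_iff_has_vector_derivative has_vector_derivative_at_within)
    qed simp
    finally show ?thesis by (simp add: p_def)
  qed
  have D: "(\<psi> has_derivative (\<lambda>v. \<Sum>k\<in>UNIV. v $ k * w k x)) (at x)" if x: "x \<in> ball x0 r" for x
  proof -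
    have "(\<psi> has_derivative blinfun_apply (integral (cbox 0 1) (G x))) (at x within ball x0 r)"
      unfolding \<psi>_def
      by (rule leibniz_rule[OF _ int contG x convex_ball])
        (use dg G in \<open>auto intro: has_derivative_at_withinI\<close>)
    then show ?thesis
      unfolding at_within_open[OF x open_ball] eval[OF x, abs_def] .
  qed
  moreover have "smooth_on (ball x0 r) \<psi>"
    by (rule smooth_onI[OF open_ball D]) (auto intro!: smooth_on_sum smooth_on_mult smooth_on_const w)
  ultimately show ?thesis by blast
qed

section \<open>Weyl connections in coordinates\<close>

lemma matrix_inv_works:
  assumes "invertible A"
  shows "A ** matrix_inv A = mat 1" "matrix_inv A ** A = mat 1"
  using someI_ex[OF assms[unfolded invertible_def]] unfolding matrix_inv_def by blast+

lemma matrix_inv_unique: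
  fixes A :: "'a::semiring_1 ^ 'n::finite ^ 'n"
  assumes "A ** B = mat 1" "B ** A = mat 1"
  shows "matrix_inv A = B"
proof -
  have "invertible A" using assms unfolding invertible_def by blast
  have "matrix_inv A = matrix_inv A ** (A ** B)"
    by (simp add: assms matrix_mul_rid)
  also have "\<dots> = B"
    by (simp add: matrix_mul_assoc matrix_inv_works[OF \<open>invertible A\<close>] matrix_mul_lid)
  finally show ?thesis .
qed

lemma matrix_inv_scaleR:
  fixes A :: "real ^ 'n::finite ^ 'n"
  assumes "invertible A" "c \<noteq> 0"
  shows "matrix_inv (c *\<^sub>R A) = (1 / c) *\<^sub>R matrix_inv A"
  by (rule matrix_inv_unique) (use assms matrix_inv_works[OF assms(1)] in \<open>simp_all add: matrix_scalar_ac\<close>)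

lemma matrix_inv_cramer:
  fixes A :: "real ^ 'n::finite ^ 'n"
  assumes "invertible A"
  shows "matrix_inv A $ i $ j = det (\<chi> r s. if s = i then axis j 1 $ r else A $ r $ s) / det A"
proof -
  have "A *v (\<chi> k. matrix_inv A $ k $ j) = axis j 1"
    using matrix_inv_works(1)[OF assms]
    by (simp add: vec_eq_iff matrix_vector_mult_def matrix_matrix_mult_def mat_def axis_def)
  moreover have "det A \<noteq> 0" using assms by (simp add: invertible_det_nz)
  ultimately have "(\<chi> k. matrix_inv A $ k $ j) =
      (\<chi> k. det (\<chi> r s. if s = k then axis j 1 $ r else A $ r $ s) / det A)"
    using cramer[of A] by blast
  then show ?thesis by (simp add: vec_eq_iff)
qed

lemma smooth_on_det:
  fixes A :: "'a::real_normed_vector \<Rightarrow> real ^ 'n::finite ^ 'n"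
  assumes "open S" "\<And>i j. smooth_on S (\<lambda>x. A x $ i $ j)"
  shows "smooth_on S (\<lambda>x. det (A x))"
  unfolding det_def
  by (intro smooth_on_sum smooth_on_mult smooth_on_prod smooth_on_const assms)

text \<open>By Cramer's rule each entry of the inverse is a quotient of determinants, which are
  polynomials in the entries, with nonvanishing denominator.\<close>

lemma smooth_on_matrix_inv:
  fixes A :: "'a::real_normed_vector \<Rightarrow> real ^ 'n::finite ^ 'n"
  assumes "open S" "\<And>i j. smooth_on S (\<lambda>x. A x $ i $ j)" "\<And>x. x \<in> S \<Longrightarrow> invertible (A x)"
  shows "smooth_on S (\<lambda>x. matrix_inv (A x) $ i $ j)"
proof (rule smooth_on_transform[OF assms(1)])
  have "smooth_on S (\<lambda>x. (\<chi> r s. if s = i then axis j 1 $ r else A x $ r $ s) $ p $ q)" for p q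
    using smooth_on_const assms(2) by (cases "q = i") simp_all
  then show "smooth_on S (\<lambda>x. det (\<chi> r s. if s = i then axis j 1 $ r else A x $ r $ s) / det (A x))"
    using assms(3) by (intro smooth_on_divide smooth_on_det assms(1,2)) (auto simp: invertible_det_nz)
qed (simp add: matrix_inv_cramer assms(3))

lemma sum_antisymmetric:
  fixes u :: "'i \<Rightarrow> 'i \<Rightarrow> real"
  assumes "\<And>i j. u i j = - u j i"
  shows "(\<Sum>i\<in>I. \<Sum>j\<in>I. u i j) = 0"
proof -
  have "(\<Sum>i\<in>I. \<Sum>j\<in>I. u i j) = (\<Sum>j\<in>I. \<Sum>i\<in>I. u i j)" by (rule sum.swap)
  also have "\<dots> = (\<Sum>j\<in>I. \<Sum>i\<in>I. - u j i)" by (intro sum.cong refl, rule assms)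
  finally show ?thesis by (simp add: sum_negf)
qed

text \<open>For a torsion-free connection, the divergence of \<Gamma> and the product of the trace
  with \<Gamma> are symmetric in \<open>l\<close> and \<open>k\<close>. So is the remaining
  quadratic term, after renaming its two summation indices. Only the derivative of the trace is
  left.\<close>

lemma ricci_antisymmetric_part:
  assumes S: "open S" "x \<in> S"
    and smooth: "\<And>k i j. smooth_on S (\<Gamma> k i j)"
    and sym: "\<And>k i j x. x \<in> S \<Longrightarrow> \<Gamma> k i j x = \<Gamma> k j i x"
  shows "ricci \<Gamma> l k x - ricci \<Gamma> k l x =
    partial l (\<lambda>x. \<Sum>i\<in>UNIV. \<Gamma> i i k x) x - partial k (\<lambda>x. \<Sum>i\<in>UNIV. \<Gamma> i i l x) x"
proof -
  have tr: "partial k (\<lambda>x. \<Sum>i\<in>UNIV. \<Gamma> i i l x) x = (\<Sum>i\<in>UNIV. partial k (\<Gamma> i i l) x)" for k l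
    by (intro partial_sum smooth_on_differentiable[OF smooth S(2)])
  have 1: "partial i (\<Gamma> i k l) x = partial i (\<Gamma> i l k) x" for i k l
    by (rule partial_cong[OF S sym])
  have 2: "(\<Sum>i\<in>UNIV. \<Sum>p\<in>UNIV. \<Gamma> i k p x * \<Gamma> p i l x) = (\<Sum>i\<in>UNIV. \<Sum>p\<in>UNIV. \<Gamma> i l p x * \<Gamma> p i k x)"
    by (subst sum.swap) (simp add: sym[OF S(2), of _ _ k] sym[OF S(2), of _ _ l] mult.commute)
  show ?thesis
    unfolding ricci_def curvature_def tr
    by (simp add: sum.distrib sum_subtractf 1[of _ k l] 2 sym[OF S(2), of _ k l])
qed

text \<open>The torsion-free connection with \<open>\<nabla>g = 2mf \<otimes> g\<close>; for \<open>m = 0\<close> it is the Levi-Civita connection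
  of \<open>g\<close>.\<close>

definition weyl_conn ::
  "real \<Rightarrow> (real ^ 'n \<Rightarrow> real ^ 'n ^ 'n) \<Rightarrow> ('n \<Rightarrow> real ^ 'n \<Rightarrow> real) \<Rightarrow> ('n::finite) conn" where
  "weyl_conn m g f k i j x = (\<Sum>l\<in>UNIV. matrix_inv (g x) $ k $ l *
     ((partial i (\<lambda>x. g x $ l $ j) x + partial j (\<lambda>x. g x $ i $ l) x - partial l (\<lambda>x. g x $ i $ j) x) / 2
      + m * (g x $ i $ j * f l x - g x $ j $ l * f i x - g x $ l $ i * f j x)))"

text \<open>The situation in a single chart. Here \<open>f\<close> holds the covariant components,
  those of \<open>lower a f\<close>, and is not assumed closed. The parameter \<open>m\<close> is
  arbitrary, so that \<open>m = 0\<close> covers Levi-Civita connections as well.\<close>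

locale weyl_coordinates =
  fixes S :: "(real ^ 'n::finite) set" and m :: real
    and g :: "real ^ 'n \<Rightarrow> real ^ 'n ^ 'n" and f :: "'n \<Rightarrow> real ^ 'n \<Rightarrow> real"
  assumes open_S: "open S"
    and smooth_g: "\<And>i j. smooth_on S (\<lambda>x. g x $ i $ j)"
    and sym_g: "\<And>x i j. x \<in> S \<Longrightarrow> g x $ i $ j = g x $ j $ i"
    and inv_g: "\<And>x. x \<in> S \<Longrightarrow> invertible (g x)"
    and smooth_f: "\<And>i. smooth_on S (f i)"
begin

abbreviation G :: "real ^ 'n \<Rightarrow> 'n \<Rightarrow> 'n \<Rightarrow> real" where
  "G x i j \<equiv> matrix_inv (g x) $ i $ j"

lemma contract_left: "x \<in> S \<Longrightarrow> (\<Sum>k\<in>UNIV. G x i k * g x $ k $ j) = (if i = j then 1 else 0)"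
  using matrix_inv_works(2)[OF inv_g] by (simp add: vec_eq_iff matrix_matrix_mult_def mat_def)

lemma contract_right: "x \<in> S \<Longrightarrow> (\<Sum>k\<in>UNIV. g x $ i $ k * G x k j) = (if i = j then 1 else 0)"
  using matrix_inv_works(1)[OF inv_g] by (simp add: vec_eq_iff matrix_matrix_mult_def mat_def)

text \<open>Needed in two places: to lower the upper index of \<open>weyl_conn\<close>, and to
  recover the components of \<open>b\<close> from the raised ones.\<close>

lemma lower_raise:
  assumes "x \<in> S"
  shows "(\<Sum>k\<in>UNIV. g x $ r $ k * (\<Sum>l\<in>UNIV. G x k l * c l)) = c r"
proof -
  have "(\<Sum>k\<in>UNIV. g x $ r $ k * (\<Sum>l\<in>UNIV. G x k l * c l)) =
      (\<Sum>l\<in>UNIV. (\<Sum>k\<in>UNIV. g x $ r $ k * G x k l) * c l)"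
    unfolding sum_distrib_left sum_distrib_right by (subst sum.swap) (simp add: mult.assoc)
  also have "\<dots> = c r" by (simp add: contract_right[OF assms] if_distrib if_distribR cong: if_cong)
  finally show ?thesis .
qed

lemma sym_G: "x \<in> S \<Longrightarrow> G x i j = G x j i"
proof -
  assume x: "x \<in> S"
  have "transpose (g x) = g x" using sym_g[OF x] by (simp add: transpose_def vec_eq_iff)
  then have "g x ** transpose (matrix_inv (g x)) = transpose (matrix_inv (g x) ** g x)"
      "transpose (matrix_inv (g x)) ** g x = transpose (g x ** matrix_inv (g x))"
    by (simp_all add: matrix_transpose_mul)
  then have "matrix_inv (g x) = transpose (matrix_inv (g x))"
    by (intro matrix_inv_unique) (simp_all add: matrix_inv_works[OF inv_g[OF x]] transpose_mat)
  then have "G x i j = transpose (matrix_inv (g x)) $ i $ j" by (rule arg_cong)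
  then show ?thesis by (simp add: transpose_def)
qed

lemma smooth_G: "smooth_on S (\<lambda>x. G x i j)"
  by (rule smooth_on_matrix_inv[OF open_S smooth_g inv_g])

lemma smooth_weyl_conn: "smooth_on S (weyl_conn m g f k i j)"
  unfolding weyl_conn_def[abs_def]
  by (intro smooth_on_sum smooth_on_mult smooth_on_add smooth_on_diff smooth_on_divide smooth_G
      smooth_on_partial smooth_g smooth_f smooth_on_const open_S) simp

lemma weyl_conn_sym:
  assumes x: "x \<in> S"
  shows "weyl_conn m g f k i j x = weyl_conn m g f k j i x"
proof -
  have "partial l (\<lambda>x. g x $ i $ j) x = partial l (\<lambda>x. g x $ j $ i) x" for l i j
    by (rule partial_cong[OF open_S x sym_g])
  note pg = this
  show ?thesis unfolding weyl_conn_def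
  proof (rule sum.cong[OF refl], goal_cases)
    case (1 l)
    show ?case
      using pg[of i l j] pg[of j i l] pg[of l i j] sym_g[OF x, of i j] sym_g[OF x, of l i] sym_g[OF x, of l j]
      by (simp add: algebra_simps)
  qed
qed

lemma weyl_conn_lowered:
  assumes "x \<in> S"
  shows "(\<Sum>k\<in>UNIV. g x $ r $ k * weyl_conn m g f k i j x) =
     (partial i (\<lambda>x. g x $ r $ j) x + partial j (\<lambda>x. g x $ i $ r) x - partial r (\<lambda>x. g x $ i $ j) x) / 2
      + m * (g x $ i $ j * f r x - g x $ j $ r * f i x - g x $ r $ i * f j x)"
  unfolding weyl_conn_def by (rule lower_raise[OF assms])

text \<open>Differentiate the identity stating that the inverse times \<open>g x\<close> is the unit
  matrix, then multiply by the inverse from the right.\<close>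

lemma partial_G:
  assumes x: "x \<in> S"
  shows "(\<chi> i j. partial k (\<lambda>x. G x i j) x) =
    - (matrix_inv (g x) ** (\<chi> i j. partial k (\<lambda>x. g x $ i $ j) x) ** matrix_inv (g x))"
    (is "?dG = - (?P ** ?dg ** ?P)")
proof -
  have "partial k (\<lambda>x. \<Sum>q\<in>UNIV. G x i q * g x $ q $ j) x = partial k (\<lambda>x. if i = j then 1 else 0) x" for i j
    by (rule partial_cong[OF open_S x contract_left])
  moreover have "partial k (\<lambda>x. \<Sum>q\<in>UNIV. G x i q * g x $ q $ j) x =
      (\<Sum>q\<in>UNIV. G x i q * partial k (\<lambda>x. g x $ q $ j) x + partial k (\<lambda>x. G x i q) x * g x $ q $ j)" for i j
    using smooth_on_differentiable[OF smooth_g x] smooth_on_differentiable[OF smooth_G x]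
    by (subst partial_sum) (auto intro!: differentiable_mult simp: partial_mult)
  ultimately have "?P ** ?dg + ?dG ** g x = 0"
    by (simp add: vec_eq_iff matrix_matrix_mult_def sum.distrib)
  then have "?dG ** g x = - (?P ** ?dg)" by (simp add: add_eq_0_iff)
  then have "?dG ** g x ** ?P = - (?P ** ?dg) ** ?P" by simp
  moreover have "?dG ** g x ** ?P = ?dG"
    by (simp add: matrix_mul_assoc[symmetric] matrix_inv_works[OF inv_g[OF x]] matrix_mul_rid)
  moreover have "- (?P ** ?dg) ** ?P = - (?P ** ?dg ** ?P)"
    by (simp add: matrix_matrix_mult_def vec_eq_iff sum_negf)
  ultimately show ?thesis by simp
qed

text \<open>The inner sum is the partial derivative of ln |det g|. Differentiating it once more
  gives second derivatives of \<open>g\<close>, which commute, and minus the trace of a product of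
  two matrices, whose order does not matter under the trace.\<close>

lemma volume_form_closed:
  assumes x: "x \<in> S"
  shows "partial k (\<lambda>x. \<Sum>i\<in>UNIV. \<Sum>j\<in>UNIV. G x i j * partial l (\<lambda>x. g x $ j $ i) x) x =
    partial l (\<lambda>x. \<Sum>i\<in>UNIV. \<Sum>j\<in>UNIV. G x i j * partial k (\<lambda>x. g x $ j $ i) x) x"
proof -
  let ?P = "matrix_inv (g x)"
  let ?dg = "\<lambda>k. \<chi> i j. partial k (\<lambda>x. g x $ i $ j) x"
  note diff = smooth_on_differentiable[OF _ x]
  have expand: "partial k (\<lambda>x. \<Sum>i\<in>UNIV. \<Sum>j\<in>UNIV. G x i j * partial l (\<lambda>x. g x $ j $ i) x) x =
      (\<Sum>i\<in>UNIV. \<Sum>j\<in>UNIV. G x i j * partial k (partial l (\<lambda>x. g x $ j $ i)) x)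
      + trace ((\<chi> i j. partial k (\<lambda>x. G x i j) x) ** ?dg l)" for k l
  proof -
    have "partial k (\<lambda>x. \<Sum>i\<in>UNIV. \<Sum>j\<in>UNIV. G x i j * partial l (\<lambda>x. g x $ j $ i) x) x =
        (\<Sum>i\<in>UNIV. \<Sum>j\<in>UNIV. partial k (\<lambda>x. G x i j * partial l (\<lambda>x. g x $ j $ i) x) x)"
      by (subst partial_sum, (intro diff smooth_on_sum smooth_on_mult open_S smooth_G smooth_on_partial smooth_g)[1])
        (intro sum.cong refl partial_sum diff smooth_on_mult open_S smooth_G smooth_on_partial smooth_g)
    also have "\<dots> = (\<Sum>i\<in>UNIV. \<Sum>j\<in>UNIV. G x i j * partial k (partial l (\<lambda>x. g x $ j $ i)) x
        + partial k (\<lambda>x. G x i j) x * partial l (\<lambda>x. g x $ j $ i) x)"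
      by (intro sum.cong refl partial_mult diff smooth_G smooth_on_partial smooth_g)
    finally show ?thesis
      by (simp add: sum.distrib trace_def matrix_matrix_mult_def)
  qed
  have "trace ((\<chi> i j. partial k (\<lambda>x. G x i j) x) ** ?dg l) = - trace (?P ** ?dg k ** (?P ** ?dg l))" for k l
  proof -
    have "trace (- A ** B) = - trace (A ** B)" for A B :: "real ^ 'n ^ 'n"
      by (simp add: trace_def matrix_matrix_mult_def sum_negf)
    then show ?thesis unfolding partial_G[OF x] by (simp add: matrix_mul_assoc)
  qed
  moreover have "trace (?P ** ?dg k ** (?P ** ?dg l)) = trace (?P ** ?dg l ** (?P ** ?dg k))"
    by (rule trace_mul_sym)
  moreover have "partial k (partial l (\<lambda>x. g x $ j $ i)) x = partial l (partial k (\<lambda>x. g x $ j $ i)) x" for i j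
    by (rule partial_commute[OF open_S x smooth_g])
  ultimately show ?thesis unfolding expand by simp
qed

lemma weyl_conn_trace:
  assumes x: "x \<in> S"
  shows "(\<Sum>i\<in>UNIV. weyl_conn m g f i i l x) =
    1 / 2 * (\<Sum>i\<in>UNIV. \<Sum>j\<in>UNIV. G x i j * partial l (\<lambda>x. g x $ j $ i) x) - m * CARD('n) * f l x"
proof -
  have pg: "partial l (\<lambda>x. g x $ i $ j) x = partial l (\<lambda>x. g x $ j $ i) x" for l i j
    by (rule partial_cong[OF open_S x sym_g])
  \<comment> \<open>These are the terms of the trace that are antisymmetric in the summation
    indices; contracted with the symmetric inverse metric they vanish.\<close>
  define u where "u = (\<lambda>i j. G x i j * ((partial i (\<lambda>x. g x $ j $ l) x - partial j (\<lambda>x. g x $ i $ l) x) / 2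
    + m * (g x $ i $ l * f j x - g x $ j $ l * f i x)))"
  have "u i j = - u j i" for i j
    by (simp add: u_def sym_G[OF x, of i j] field_simps)
  then have u: "(\<Sum>i\<in>UNIV. \<Sum>j\<in>UNIV. u i j) = 0" by (rule sum_antisymmetric)
  have "(\<Sum>i\<in>UNIV. weyl_conn m g f i i l x) =
      (\<Sum>i\<in>UNIV. \<Sum>j\<in>UNIV. 1 / 2 * (G x i j * partial l (\<lambda>x. g x $ j $ i) x) + u i j
        - m * f l x * (G x i j * g x $ j $ i))"
    unfolding weyl_conn_def u_def
    by (intro sum.cong refl) (simp add: pg[of l] sym_g[OF x, of l] algebra_simps add_divide_distrib diff_divide_distrib)
  also have "\<dots> = 1 / 2 * (\<Sum>i\<in>UNIV. \<Sum>j\<in>UNIV. G x i j * partial l (\<lambda>x. g x $ j $ i) x)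
      - m * f l x * (\<Sum>i\<in>UNIV. \<Sum>j\<in>UNIV. G x i j * g x $ j $ i)"
    by (simp only: sum.distrib sum_subtractf u add_0_right flip: sum_distrib_left)
  finally show ?thesis unfolding contract_left[OF x] by simp
qed

lemma ricci_weyl_conn:
  assumes x: "x \<in> S"
  shows "ricci (weyl_conn m g f) l k x - ricci (weyl_conn m g f) k l x =
    m * CARD('n) * (partial k (f l) x - partial l (f k) x)"
proof -
  let ?T = "\<lambda>l x. \<Sum>i\<in>UNIV. \<Sum>j\<in>UNIV. G x i j * partial l (\<lambda>x. g x $ j $ i) x"
  have T: "?T l differentiable (at x)" for l
    by (intro smooth_on_differentiable[OF _ x] smooth_on_sum smooth_on_mult open_S smooth_G smooth_on_partial smooth_g)
  have f: "f l differentiable (at x)" for l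
    by (rule smooth_on_differentiable[OF smooth_f x])
  have D: "partial l (\<lambda>x. \<Sum>i\<in>UNIV. weyl_conn m g f i i k x) x =
      1 / 2 * partial l (?T k) x - m * CARD('n) * partial l (f k) x" for l k
  proof -
    have "partial l (\<lambda>x. \<Sum>i\<in>UNIV. weyl_conn m g f i i k x) x =
        partial l (\<lambda>x. 1 / 2 * ?T k x - m * CARD('n) * f k x) x"
      by (rule partial_cong[OF open_S x weyl_conn_trace])
    also have "\<dots> = partial l (\<lambda>x. 1 / 2 * ?T k x) x - partial l (\<lambda>x. m * CARD('n) * f k x) x"
      by (intro partial_diff differentiable_mult differentiable_const T f)
    finally show ?thesis by (simp only: partial_cmult[OF T] partial_cmult[OF f])
  qed
  have "ricci (weyl_conn m g f) l k x - ricci (weyl_conn m g f) k l x =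
      partial l (\<lambda>x. \<Sum>i\<in>UNIV. weyl_conn m g f i i k x) x
      - partial k (\<lambda>x. \<Sum>i\<in>UNIV. weyl_conn m g f i i l x) x"
    by (rule ricci_antisymmetric_part[OF open_S x smooth_weyl_conn weyl_conn_sym])
  then show ?thesis
    unfolding D using volume_form_closed[OF x, of k l] by (simp add: algebra_simps)
qed

text \<open>This is \<nabla>g = 2mf \<otimes> g evaluated on the pair \<open>y\<close>,
  \<open>y\<close>. In this form it gives the derivative of the quadratic form of \<open>g\<close>
  along the horizontal lift of the \<open>i\<close>-th coordinate vector.\<close>

lemma weyl_conn_metric:
  assumes x: "x \<in> S"
  shows "(\<Sum>r\<in>UNIV. \<Sum>s\<in>UNIV. partial i (\<lambda>x. g x $ r $ s) x * (y $ r * y $ s))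
    - 2 * (\<Sum>l\<in>UNIV. (\<Sum>s\<in>UNIV. weyl_conn m g f l i s x * y $ s) * (\<Sum>r\<in>UNIV. g x $ l $ r * y $ r))
    = 2 * m * f i x * (\<Sum>r\<in>UNIV. \<Sum>s\<in>UNIV. g x $ r $ s * (y $ r * y $ s))"
proof -
  have pg: "partial l (\<lambda>x. g x $ i $ j) x = partial l (\<lambda>x. g x $ j $ i) x" for l i j
    by (rule partial_cong[OF open_S x sym_g])
  \<comment> \<open>After lowering the index, everything except the wanted term is antisymmetric in
    \<open>r\<close> and \<open>s\<close> and disappears against
    \<open>y $ r * y $ s\<close>.\<close>
  define u where "u = (\<lambda>r s. (partial r (\<lambda>x. g x $ i $ s) x - partial s (\<lambda>x. g x $ i $ r) x
    + 2 * m * (g x $ r $ i * f s x - g x $ i $ s * f r x)) * (y $ r * y $ s))"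
  have "u r s = - u s r" for r s
    by (simp add: u_def sym_g[OF x, of i] algebra_simps)
  then have u: "(\<Sum>r\<in>UNIV. \<Sum>s\<in>UNIV. u r s) = 0" by (rule sum_antisymmetric)
  have "(\<Sum>l\<in>UNIV. (\<Sum>s\<in>UNIV. weyl_conn m g f l i s x * y $ s) * (\<Sum>r\<in>UNIV. g x $ l $ r * y $ r))
      = (\<Sum>l\<in>UNIV. \<Sum>r\<in>UNIV. \<Sum>s\<in>UNIV. g x $ r $ l * weyl_conn m g f l i s x * (y $ r * y $ s))"
    by (rule sum.cong[OF refl], subst mult.commute) (simp add: sum_product sym_g[OF x] mult_ac)
  also have "\<dots> = (\<Sum>r\<in>UNIV. \<Sum>s\<in>UNIV. (\<Sum>l\<in>UNIV. g x $ r $ l * weyl_conn m g f l i s x) * (y $ r * y $ s))"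
    unfolding sum_distrib_right
    by (subst sum.swap) (intro sum.cong refl sum.swap)
  finally have X: "(\<Sum>l\<in>UNIV. (\<Sum>s\<in>UNIV. weyl_conn m g f l i s x * y $ s) * (\<Sum>r\<in>UNIV. g x $ l $ r * y $ r)) =
      (\<Sum>r\<in>UNIV. \<Sum>s\<in>UNIV. ((partial i (\<lambda>x. g x $ r $ s) x + partial s (\<lambda>x. g x $ i $ r) x - partial r (\<lambda>x. g x $ i $ s) x) / 2
      + m * (g x $ i $ s * f r x - g x $ s $ r * f i x - g x $ r $ i * f s x)) * (y $ r * y $ s))"
    unfolding weyl_conn_lowered[OF x] .
  have "(\<Sum>r\<in>UNIV. \<Sum>s\<in>UNIV. partial i (\<lambda>x. g x $ r $ s) x * (y $ r * y $ s))
    - 2 * (\<Sum>l\<in>UNIV. (\<Sum>s\<in>UNIV. weyl_conn m g f l i s x * y $ s) * (\<Sum>r\<in>UNIV. g x $ l $ r * y $ r))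
    = (\<Sum>r\<in>UNIV. \<Sum>s\<in>UNIV. u r s + 2 * m * f i x * (g x $ r $ s * (y $ r * y $ s)))"
    unfolding X unfolding sum_distrib_left sum_subtractf[symmetric] u_def
    by (intro sum.cong refl) (simp add: sym_g[OF x] field_simps)
  also have "\<dots> = 2 * m * f i x * (\<Sum>r\<in>UNIV. \<Sum>s\<in>UNIV. g x $ r $ s * (y $ r * y $ s))"
    by (simp only: sum.distrib u add_0_left flip: sum_distrib_left)
  finally show ?thesis .
qed

lemma weyl_conn_split:
  "weyl_conn m g f k i j x = weyl_conn 0 g f k i j x
    + m * (\<Sum>l\<in>UNIV. G x k l * (g x $ i $ j * f l x - g x $ j $ l * f i x - g x $ l $ i * f j x))"
  by (simp add: weyl_conn_def distrib_left sum.distrib sum_distrib_left mult_ac)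

text \<open>With \<open>d\<close> for the partial derivative of \<open>b i\<close>, the assumption
  is the equation for \<open>f\<close> read with the Levi-Civita connection. The correction in
  \<open>weyl_conn\<close>, contracted with \<open>b\<close>, is m times the metric term minus
  \<open>f j x * b i\<close> minus \<open>f i x * b j\<close>. Subtracting it cancels the metric
  term and \<open>- m * f i x * b j\<close>, and raises the coefficient of
  \<open>b i * f j x\<close> from 1 to 1 + m.\<close>

lemma weyl_conn_one_form:
  assumes x: "x \<in> S"
    and d: "d - (\<Sum>k\<in>UNIV. weyl_conn 0 g f k j i x * b k) =
      m * (\<Sum>k\<in>UNIV. f k x * (\<Sum>l\<in>UNIV. G x k l * b l)) * g x $ i $ j + b i * f j x - m * f i x * b j"
  shows "d - (\<Sum>k\<in>UNIV. weyl_conn m g f k j i x * b k) = (1 + m) * b i * f j x"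
proof -
  define B where "B = (\<lambda>l. \<Sum>k\<in>UNIV. G x l k * b k)"
  have B: "(\<Sum>k\<in>UNIV. G x l k * b k) = B l" for l by (simp add: B_def)
  have lower_B: "(\<Sum>l\<in>UNIV. g x $ r $ l * B l) = b r" for r
    unfolding B_def by (rule lower_raise[OF x])
  have "(\<Sum>k\<in>UNIV. weyl_conn m g f k j i x * b k) = (\<Sum>k\<in>UNIV. weyl_conn 0 g f k j i x * b k)
      + m * (\<Sum>k\<in>UNIV. \<Sum>l\<in>UNIV. G x k l * b k * (g x $ j $ i * f l x - g x $ i $ l * f j x - g x $ l $ j * f i x))"
    unfolding weyl_conn_split[of _ j i] by (simp add: algebra_simps sum.distrib sum_distrib_left)
  also have "(\<Sum>k\<in>UNIV. \<Sum>l\<in>UNIV. G x k l * b k * (g x $ j $ i * f l x - g x $ i $ l * f j x - g x $ l $ j * f i x))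
      = (\<Sum>l\<in>UNIV. B l * (g x $ i $ j * f l x - g x $ i $ l * f j x - g x $ j $ l * f i x))"
    unfolding B_def sum_distrib_right
    by (subst sum.swap) (intro sum.cong refl, simp add: sym_G[OF x] sym_g[OF x] mult_ac)
  also have "\<dots> = g x $ i $ j * (\<Sum>l\<in>UNIV. f l x * B l) - f j x * (\<Sum>l\<in>UNIV. g x $ i $ l * B l)
      - f i x * (\<Sum>l\<in>UNIV. g x $ j $ l * B l)"
    by (simp add: algebra_simps sum_subtractf sum.distrib sum_distrib_left)
  finally show ?thesis
    using d unfolding lower_B B by (simp add: algebra_simps)
qed

text \<open>Each derivative of the rescaled metric is the factor times the derivative of
  \<open>g\<close> minus 2mf times \<open>g\<close>. In the Christoffel symbols the three extra
  terms, halved, are precisely the f-terms of \<open>weyl_conn\<close>, and the factor cancels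
  against that of the inverse.\<close>

lemma weyl_conn_conformal:
  assumes x: "x \<in> S" and \<psi>: "smooth_on S \<psi>" and f: "\<And>i. f i x = partial i \<psi> x"
  shows "weyl_conn 0 (\<lambda>x. exp (- 2 * m * \<psi> x) *\<^sub>R g x) h k i j x = weyl_conn m g f k i j x"
proof -
  let ?e = "\<lambda>x. exp (- 2 * m * \<psi> x)"
  have "(\<psi> has_derivative frechet_derivative \<psi> (at x)) (at x)"
    by (rule smooth_on_has_derivative[OF \<psi> x])
  then have "(?e has_derivative (\<lambda>v. ?e x * (- 2 * m * frechet_derivative \<psi> (at x) v))) (at x)"
    by (auto intro!: derivative_eq_intros)
  then have e: "partial i ?e x = ?e x * (- 2 * m * f i x)" and e_diff: "?e differentiable (at x)" for i
    unfolding f partial_def[of i \<psi>] by (auto dest: has_derivative_imp_partial intro: differentiableI)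
  have dg: "partial i (\<lambda>x. (?e x *\<^sub>R g x) $ r $ s) x =
      ?e x * (partial i (\<lambda>x. g x $ r $ s) x - 2 * m * f i x * g x $ r $ s)" for i r s
    using partial_mult[OF e_diff smooth_on_differentiable[OF smooth_g x], of i r s]
    unfolding e by (simp add: algebra_simps)
  have dG: "matrix_inv (?e x *\<^sub>R g x) = (1 / ?e x) *\<^sub>R matrix_inv (g x)"
    by (rule matrix_inv_scaleR[OF inv_g[OF x]]) simp
  show ?thesis
    unfolding weyl_conn_def dg dG
  proof (rule sum.cong[OF refl], goal_cases)
    case (1 l)
    have "g x $ l $ i = g x $ i $ l" "g x $ j $ l = g x $ l $ j" by (simp_all add: sym_g[OF x])
    then show ?case by (simp add: field_simps)
  qed
qed

end

section \<open>Charts and components\<close>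

locale manifold =
  fixes M :: "'p topology" and atlas :: "('p, 'n::finite) chart set"
  assumes manifold: "smooth_manifold M atlas"
begin

section \<open>Charts, their inverses and their images\<close>

lemma chart_open: "c \<in> atlas \<Longrightarrow> openin M (fst c)"
  using manifold unfolding smooth_manifold_def by blast

lemma chart_subset: "c \<in> atlas \<Longrightarrow> fst c \<subseteq> topspace M"
  using chart_open openin_subset by blast

lemma chart_cover: "p \<in> topspace M \<Longrightarrow> \<exists>c\<in>atlas. p \<in> fst c"
  using manifold unfolding smooth_manifold_def by blast

lemma chart_homeomorphic:
  "c \<in> atlas \<Longrightarrow> homeomorphic_map (subtopology M (fst c)) (top_of_set (snd c ` fst c)) (snd c)"
  using manifold unfolding smooth_manifold_def by blast

lemma chart_inj: "c \<in> atlas \<Longrightarrow> inj_on (snd c) (fst c)"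
  using homeomorphic_imp_injective_map[OF chart_homeomorphic] chart_subset
  by (metis inf.absorb2 topspace_subtopology)

lemma chart_inv_f: "c \<in> atlas \<Longrightarrow> p \<in> fst c \<Longrightarrow> chart_inv c (snd c p) = p"
  by (rule inv_into_f_f[OF chart_inj])

lemma chart_f_inv: "x \<in> snd c ` fst c \<Longrightarrow> snd c (chart_inv c x) = x"
  by (rule f_inv_into_f)

lemma chart_inv_in: "x \<in> snd c ` fst c \<Longrightarrow> chart_inv c x \<in> fst c"
  by (rule inv_into_into)

lemma chart_image_iff:
  assumes "c \<in> atlas"
  shows "x \<in> chart_image c U \<longleftrightarrow> x \<in> snd c ` fst c \<and> chart_inv c x \<in> U"
  using chart_inv_f[OF assms] chart_f_inv[of x c] by force

lemma open_chart_image: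
  assumes c: "c \<in> atlas" and U: "openin M U"
  shows "open (chart_image c U)"
proof -
  have "openin (subtopology M (fst c)) (fst c \<inter> U)"
    using U openin_subtopology_Int2 by blast
  then have "openin (top_of_set (snd c ` fst c)) (snd c ` (fst c \<inter> U))"
    using homeomorphic_imp_open_map[OF chart_homeomorphic[OF c]] unfolding open_map_def by blast
  moreover have "open (snd c ` fst c)"
    using manifold c unfolding smooth_manifold_def by blast
  ultimately show ?thesis by (rule openin_open_trans)
qed

lemma open_chart_range: "c \<in> atlas \<Longrightarrow> open (snd c ` fst c)"
  using manifold unfolding smooth_manifold_def by blast

lemma openin_chart_preimage:
  assumes c: "c \<in> atlas" and B: "open B"
  shows "openin M {p \<in> fst c. snd c p \<in> B}"
proof -
  have "openin (top_of_set (snd c ` fst c)) (snd c ` fst c \<inter> B)"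
    using B by (simp add: openin_open_Int)
  from openin_continuous_map_preimage[OF homeomorphic_imp_continuous_map[OF chart_homeomorphic[OF c]] this]
  have "openin (subtopology M (fst c)) {p \<in> topspace (subtopology M (fst c)). snd c p \<in> snd c ` fst c \<inter> B}" .
  moreover have "{p \<in> topspace (subtopology M (fst c)). snd c p \<in> snd c ` fst c \<inter> B} = {p \<in> fst c. snd c p \<in> B}"
    using chart_subset[OF c] by auto
  ultimately show ?thesis
    using openin_trans_full chart_open[OF c] by metis
qed

section \<open>Transition maps and tangent vectors in coordinates\<close>

lemma transition_smooth:
  "c \<in> atlas \<Longrightarrow> d \<in> atlas \<Longrightarrow> smooth_on (chart_image c (fst d)) (transition c d)"
  using manifold unfolding smooth_manifold_def by blast

lemma transition_has_derivative:
  assumes "c \<in> atlas" "d \<in> atlas" "x \<in> snd c ` fst c" "chart_inv c x \<in> fst d"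
  shows "(transition c d has_derivative frechet_derivative (transition c d) (at x)) (at x)"
  by (rule smooth_on_has_derivative[OF transition_smooth[OF assms(1,2)]])
    (use assms chart_image_iff in blast)

text \<open>The chain rule on the common domain of three charts, where the transition maps compose
  exactly. It is what makes \<open>coord_tvec\<close> obey the transformation law of tangent
  vectors.\<close>

lemma transition_derivative_compose:
  assumes c: "c \<in> atlas" and d: "d \<in> atlas" and e: "e \<in> atlas"
    and x: "x \<in> snd c ` fst c" "chart_inv c x \<in> fst d" "chart_inv c x \<in> fst e"
  shows "frechet_derivative (transition d e) (at (transition c d x)) (frechet_derivative (transition c d) (at x) y)
    = frechet_derivative (transition c e) (at x) y"
proof -
  let ?S = "chart_image c (fst d \<inter> fst e)"
  have inv: "chart_inv d (transition c d z) = chart_inv c z" if "z \<in> ?S" for z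
    using that chart_image_iff[OF c] chart_inv_f[OF d] by auto
  have xS: "x \<in> ?S" using x chart_image_iff[OF c] by blast
  have "(transition d e has_derivative frechet_derivative (transition d e) (at (transition c d x))) (at (transition c d x))"
    by (rule transition_has_derivative[OF d e]) (use x inv[OF xS] in auto)
  from has_derivative_compose[OF transition_has_derivative[OF c d x(1,2)] this]
  have "((\<lambda>z. transition d e (transition c d z)) has_derivative
      (\<lambda>y. frechet_derivative (transition d e) (at (transition c d x)) (frechet_derivative (transition c d) (at x) y))) (at x)" .
  moreover have "transition d e (transition c d z) = transition c e z" if "z \<in> ?S" for z
    using inv[OF that] by simp
  moreover have "open ?S"
    by (intro open_chart_image c openin_Int chart_open d e)
  ultimately have "(transition c e has_derivative
      (\<lambda>y. frechet_derivative (transition d e) (at (transition c d x)) (frechet_derivative (transition c d) (at x) y))) (at x)"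
    using xS by (blast intro: has_derivative_transform_within_open)
  from frechet_derivative_at[OF this] show ?thesis by metis
qed

lemma transition_self_derivative:
  assumes c: "c \<in> atlas" and x: "x \<in> snd c ` fst c"
  shows "frechet_derivative (transition c c) (at x) y = y"
proof -
  have "((\<lambda>y. y) has_derivative (\<lambda>y. y)) (at x)" by (rule has_derivative_ident)
  then have "(transition c c has_derivative (\<lambda>y. y)) (at x)"
    by (rule has_derivative_transform_within_open[OF _ open_chart_range[OF c] x])
      (simp add: chart_f_inv)
  from frechet_derivative_at[OF this] show ?thesis by metis
qed

lemma coord_tvec_self: "c \<in> atlas \<Longrightarrow> x \<in> snd c ` fst c \<Longrightarrow> coord_tvec atlas c x y c = y"
  by (simp add: coord_tvec_def chart_inv_in transition_self_derivative)

lemma coord_tvec_in_tangent_space: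
  assumes c: "c \<in> atlas" and x: "x \<in> snd c ` fst c"
  shows "coord_tvec atlas c x y \<in> tangent_space atlas (chart_inv c x)"
  unfolding tangent_space_def coord_tvec_def
proof (intro CollectI conjI ballI allI impI, goal_cases)
  case (1 d e)
  then show ?case using transition_derivative_compose[OF c 1(1,2) x] by simp
next
  case (2 d)
  then show ?case by auto
qed

text \<open>The transformation law fixes all components by the one in the chart \<open>c\<close>. At
  all other indices both sides have the default value 0, so the equality is one of
  functions.\<close>

lemma tangent_vector_eq_coord_tvec:
  assumes c: "c \<in> atlas" and p: "p \<in> fst c" and v: "v \<in> tangent_space atlas p"
  shows "v = coord_tvec atlas c (snd c p) (v c)"
proof
  fix d
  show "v d = coord_tvec atlas c (snd c p) (v c) d"
  proof (cases "d \<in> atlas \<and> p \<in> fst d")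
    case True
    then have "v d = frechet_derivative (transition c d) (at (snd c p)) (v c)"
      using v c p unfolding tangent_space_def by blast
    then show ?thesis using True by (simp add: coord_tvec_def chart_inv_f[OF c p])
  next
    case False
    then have "v d = 0" using v unfolding tangent_space_def by blast
    then show ?thesis using False by (auto simp: coord_tvec_def chart_inv_f[OF c p])
  qed
qed

lemma coord_tvec_change_chart:
  assumes c: "c \<in> atlas" and d: "d \<in> atlas" and x: "x \<in> snd d ` fst d" "chart_inv d x \<in> fst c"
  shows "coord_tvec atlas d x y =
    coord_tvec atlas c (transition d c x) (frechet_derivative (transition d c) (at x) y)"
  using tangent_vector_eq_coord_tvec[OF c x(2) coord_tvec_in_tangent_space[OF d x(1)], of y] c x
  by (simp add: coord_tvec_def[of atlas d x y])

lemma linear_coord_tvec: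
  assumes c: "c \<in> atlas" and x: "x \<in> snd c ` fst c"
  shows "linear (\<lambda>y. coord_tvec atlas c x y d)"
proof (cases "d \<in> atlas \<and> chart_inv c x \<in> fst d")
  case True
  then show ?thesis
    using has_derivative_linear[OF transition_has_derivative[OF c _ x, of d]] by (simp add: coord_tvec_def)
next
  case False
  then have "(\<lambda>y. coord_tvec atlas c x y d) = (\<lambda>y. 0)" by (auto simp: coord_tvec_def)
  then show ?thesis by (simp add: linear_zero)
qed

lemma coord_tvec_add:
  assumes "c \<in> atlas" "x \<in> snd c ` fst c"
  shows "coord_tvec atlas c x (y + z) = tvec_add (coord_tvec atlas c x y) (coord_tvec atlas c x z)"
  using linear_add[OF linear_coord_tvec[OF assms]] by (simp add: tvec_add_def fun_eq_iff)

lemma coord_tvec_scale: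
  assumes "c \<in> atlas" "x \<in> snd c ` fst c"
  shows "coord_tvec atlas c x (r *\<^sub>R y) = tvec_scale r (coord_tvec atlas c x y)"
  using linear_cmul[OF linear_coord_tvec[OF assms]] by (simp add: tvec_scale_def fun_eq_iff)

lemma linear_form_components:
  assumes c: "c \<in> atlas" and x: "x \<in> snd c ` fst c" and \<omega>: "linear_form_at atlas (chart_inv c x) \<omega>"
  shows "\<omega> (coord_tvec atlas c x y) = (\<Sum>i\<in>UNIV. y $ i * \<omega> (coord_basis atlas c x i))"
proof (rule linear_sum_axis)
  show "linear (\<lambda>y. \<omega> (coord_tvec atlas c x y))"
    using \<omega> coord_tvec_in_tangent_space[OF c x]
    by (intro linearI) (simp_all add: coord_tvec_add[OF c x] coord_tvec_scale[OF c x] linear_form_at_def)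
qed

lemma bilinear_form_components:
  assumes c: "c \<in> atlas" and x: "x \<in> snd c ` fst c" and a: "sym_bilinear_form_at atlas (chart_inv c x) q"
  shows "q (coord_tvec atlas c x y) (coord_tvec atlas c x z) =
    (\<Sum>i\<in>UNIV. \<Sum>j\<in>UNIV. q (coord_basis atlas c x i) (coord_basis atlas c x j) * (y $ i * z $ j))"
proof -
  note T = coord_tvec_in_tangent_space[OF c x]
  have L: "linear_form_at atlas (chart_inv c x) (q (coord_tvec atlas c x w))" for w
    using a T unfolding sym_bilinear_form_at_def by blast
  have sym: "q (coord_tvec atlas c x w) (coord_tvec atlas c x w') = q (coord_tvec atlas c x w') (coord_tvec atlas c x w)" for w w'
    using a T unfolding sym_bilinear_form_at_def by blast
  have "q (coord_tvec atlas c x y) (coord_tvec atlas c x z) =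
      (\<Sum>j\<in>UNIV. z $ j * q (coord_basis atlas c x j) (coord_tvec atlas c x y))"
    unfolding linear_form_components[OF c x L, of y z]
    by (rule sum.cong[OF refl], subst sym, rule refl)
  also have "\<dots> = (\<Sum>j\<in>UNIV. \<Sum>i\<in>UNIV. q (coord_basis atlas c x i) (coord_basis atlas c x j) * (y $ i * z $ j))"
  proof (intro sum.cong refl)
    fix j
    show "z $ j * q (coord_basis atlas c x j) (coord_tvec atlas c x y) =
        (\<Sum>i\<in>UNIV. q (coord_basis atlas c x i) (coord_basis atlas c x j) * (y $ i * z $ j))"
      unfolding linear_form_components[OF c x L, of "axis j 1" y]
      by (simp add: sum_distrib_left mult_ac sym[of _ "axis j 1"])
  qed
  finally show ?thesis by (subst sum.swap)
qed

section \<open>Metrics and lowered vector fields in a chart\<close>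

definition metric_matrix :: "('p, 'n) two_tensor \<Rightarrow> ('p, 'n) chart \<Rightarrow> real ^ 'n \<Rightarrow> real ^ 'n ^ 'n" where
  "metric_matrix a c x = (\<chi> i j. tensor_comp atlas c a i j x)"

lemma metric_matrix_entry: "metric_matrix a c x $ i $ j = tensor_comp atlas c a i j x"
  by (simp add: metric_matrix_def)

lemma levi_civita_eq_weyl_conn:
  "levi_civita atlas a c k i j x = weyl_conn 0 (metric_matrix a c) f k i j x"
  unfolding levi_civita_def weyl_conn_def metric_inv_def metric_matrix_entry
  by (simp add: metric_matrix_def)

context
  fixes U a
  assumes U: "openin M U" and a: "pseudo_riemannian_metric atlas U a"
begin

lemma metric_bilinear: "p \<in> U \<Longrightarrow> sym_bilinear_form_at atlas p (a p)"
  using a unfolding pseudo_riemannian_metric_def by blast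

lemma metric_components:
  assumes c: "c \<in> atlas" and x: "x \<in> chart_image c U"
  shows "a (chart_inv c x) (coord_tvec atlas c x y) (coord_tvec atlas c x z) =
    (\<Sum>i\<in>UNIV. \<Sum>j\<in>UNIV. metric_matrix a c x $ i $ j * (y $ i * z $ j))"
  using bilinear_form_components[OF c _ metric_bilinear, of x y z] x
  by (simp add: metric_matrix_entry tensor_comp_def chart_image_iff[OF c])

text \<open>A vector in the kernel of the matrix represents a tangent vector orthogonal to all
  others, as every tangent vector has the form \<open>coord_tvec\<close>. Nondegeneracy makes it
  zero, and a matrix with trivial kernel is invertible.\<close>

lemma metric_matrix_invertible:
  assumes c: "c \<in> atlas" and x: "x \<in> chart_image c U"
  shows "invertible (metric_matrix a c x)"
proof -
  have x': "x \<in> snd c ` fst c" and p: "chart_inv c x \<in> U"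
    using x chart_image_iff[OF c] by auto
  have "y = 0" if "metric_matrix a c x *v y = 0" for y
  proof -
    have *: "(\<Sum>j\<in>UNIV. metric_matrix a c x $ i $ j * y $ j) = 0" for i
      using that by (simp add: vec_eq_iff matrix_vector_mult_def)
    have "a (chart_inv c x) (coord_tvec atlas c x y) w = 0" if w: "w \<in> tangent_space atlas (chart_inv c x)" for w
    proof -
      have w: "w = coord_tvec atlas c x (w c)"
        using tangent_vector_eq_coord_tvec[OF c chart_inv_in[OF x'] w] by (simp add: chart_f_inv[OF x'])
      have "a (chart_inv c x) (coord_tvec atlas c x y) w = a (chart_inv c x) (coord_tvec atlas c x (w c)) (coord_tvec atlas c x y)"
        using metric_bilinear[OF p] w coord_tvec_in_tangent_space[OF c x'] unfolding sym_bilinear_form_at_def by metis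
      also have "\<dots> = (\<Sum>i\<in>UNIV. w c $ i * (\<Sum>j\<in>UNIV. metric_matrix a c x $ i $ j * y $ j))"
        unfolding metric_components[OF c x] by (simp add: sum_distrib_left mult_ac)
      finally show ?thesis by (simp add: *)
    qed
    then have "coord_tvec atlas c x y = (\<lambda>_. 0)"
      using a p coord_tvec_in_tangent_space[OF c x'] unfolding pseudo_riemannian_metric_def by blast
    then show "y = 0" using coord_tvec_self[OF c x', of y] by simp
  qed
  then show ?thesis
    by (metis invertible_left_inverse matrix_left_invertible_ker)
qed

lemma weyl_coordinates_chart:
  assumes c: "c \<in> atlas" and f: "\<And>i. smooth_on (chart_image c U) (f i)"
  shows "weyl_coordinates (chart_image c U) (metric_matrix a c) f"
proof
  show "open (chart_image c U)" by (rule open_chart_image[OF c U])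
  show "smooth_on (chart_image c U) (\<lambda>x. metric_matrix a c x $ i $ j)" for i j
    using a c unfolding pseudo_riemannian_metric_def metric_matrix_entry by blast
  show "metric_matrix a c x $ i $ j = metric_matrix a c x $ j $ i" if "x \<in> chart_image c U" for x i j
    using metric_bilinear[of "chart_inv c x"] that coord_tvec_in_tangent_space[OF c, of x]
    unfolding metric_matrix_entry tensor_comp_def sym_bilinear_form_at_def chart_image_iff[OF c] by blast
  show "invertible (metric_matrix a c x)" if "x \<in> chart_image c U" for x
    by (rule metric_matrix_invertible[OF c that])
qed (rule f)

lemma form_comp_lower:
  assumes c: "c \<in> atlas" and x: "x \<in> chart_image c U" and f: "f (chart_inv c x) \<in> tangent_space atlas (chart_inv c x)"
  shows "form_comp atlas c (lower a f) i x = (\<Sum>j\<in>UNIV. metric_matrix a c x $ j $ i * f (chart_inv c x) c $ j)"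
proof -
  have x': "x \<in> snd c ` fst c" using x by auto
  have "f (chart_inv c x) = coord_tvec atlas c x (f (chart_inv c x) c)"
    using tangent_vector_eq_coord_tvec[OF c chart_inv_in[OF x'] f] by (simp add: chart_f_inv[OF x'])
  then show ?thesis
    unfolding form_comp_def lower_def
    using metric_components[OF c x, of "f (chart_inv c x) c" "axis i 1"]
    by (simp add: axis_def if_distrib cong: if_cong)
qed

lemma smooth_form_comp_lower:
  assumes c: "c \<in> atlas" and f: "smooth_vector_field atlas U f"
  shows "smooth_on (chart_image c U) (form_comp atlas c (lower a f) i)"
proof (rule smooth_on_transform)
  show "open (chart_image c U)" by (rule open_chart_image[OF c U])
  have "smooth_on (chart_image c U) (\<lambda>x. f (chart_inv c x) c $ j)" for j
    using f c unfolding smooth_vector_field_def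
    by (intro smooth_on_compose_bounded_linear[OF bounded_linear_vec_nth] open_chart_image c U) blast
  moreover have "smooth_on (chart_image c U) (\<lambda>x. metric_matrix a c x $ j $ i)" for j
    using a c unfolding pseudo_riemannian_metric_def metric_matrix_entry by blast
  ultimately show "smooth_on (chart_image c U) (\<lambda>x. \<Sum>j\<in>UNIV. metric_matrix a c x $ j $ i * f (chart_inv c x) c $ j)"
    by (intro smooth_on_sum smooth_on_mult open_chart_image c U)
  show "(\<Sum>j\<in>UNIV. metric_matrix a c x $ j $ i * f (chart_inv c x) c $ j) = form_comp atlas c (lower a f) i x"
    if "x \<in> chart_image c U" for x
    using form_comp_lower[OF c that] f that unfolding smooth_vector_field_def chart_image_iff[OF c] by simp
qed

lemma linear_form_lower:
  assumes "smooth_vector_field atlas U f" "p \<in> U"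
  shows "linear_form_at atlas p (lower a f p)"
  using metric_bilinear[OF assms(2)] assms unfolding smooth_vector_field_def sym_bilinear_form_at_def lower_def by blast

end

text \<open>The Poincare lemma is applied on a coordinate ball of one chart around \<open>p\<close>,
  and the function found is pulled back to the manifold. As \<open>potential_on\<close> refers to
  every chart, smoothness and gradient must then be transported through the transition maps.\<close>

lemma closed_one_form_potential:
  assumes closed: "closed_one_form atlas (topspace M) \<omega>"
    and smooth: "smooth_one_form atlas (topspace M) \<omega>"
    and p: "p \<in> topspace M"
  obtains U \<psi> where "openin M U" "p \<in> U" "potential_on atlas U \<omega> \<psi>"
proof -
  obtain c where c: "c \<in> atlas" "p \<in> fst c" using chart_cover[OF p] by blast
  have image_c: "chart_image c (topspace M) = snd c ` fst c"
    using chart_subset[OF c(1)] by (simp add: inf.absorb1)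
  obtain r where r: "r > 0" "ball (snd c p) r \<subseteq> snd c ` fst c"
    using open_chart_range[OF c(1)] c(2) openE by blast
  let ?B = "ball (snd c p) r"
  have s: "smooth_on ?B (form_comp atlas c \<omega> i)" for i
    using smooth c(1) r(2) smooth_on_subset unfolding smooth_one_form_def image_c[symmetric] by blast
  have cl: "partial i (form_comp atlas c \<omega> j) x = partial j (form_comp atlas c \<omega> i) x" if "x \<in> ?B" for i j x
    using closed c(1) r(2) that unfolding closed_one_form_def image_c[symmetric] by blast
  have "\<exists>\<phi>. smooth_on ?B \<phi> \<and> (\<forall>x\<in>?B. (\<phi> has_derivative (\<lambda>v. \<Sum>k\<in>UNIV. v $ k * form_comp atlas c \<omega> k x)) (at x))"
    by (rule Poincare_lemma_ball[OF s]) (rule cl)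
  then obtain \<phi> where \<phi>: "smooth_on ?B \<phi>"
    "\<forall>x\<in>?B. (\<phi> has_derivative (\<lambda>v. \<Sum>k\<in>UNIV. v $ k * form_comp atlas c \<omega> k x)) (at x)"
    by (elim exE conjE)
  define U where "U = {q \<in> fst c. snd c q \<in> ?B}"
  define \<psi> where "\<psi> = (\<lambda>q. \<phi> (snd c q))"
  have U: "openin M U" unfolding U_def by (rule openin_chart_preimage[OF c(1) open_ball])
  have sub: "chart_image d U \<subseteq> chart_image d (fst c)" for d by (auto simp: U_def)
  have B: "transition d c x \<in> ?B" if "d \<in> atlas" "x \<in> chart_image d U" for d x
    using that chart_image_iff[OF that(1)] by (auto simp: U_def)
  have "smooth_function_on atlas U \<psi>"
    unfolding smooth_function_on_def \<psi>_def
  proof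
    fix d assume d: "d \<in> atlas"
    show "smooth_on (chart_image d U) (\<lambda>x. \<phi> (transition d c x))"
      using B[OF d] smooth_on_subset[OF transition_smooth[OF d c(1)] sub]
      by (intro smooth_on_compose[OF open_chart_image[OF d U] open_ball _ _ \<phi>(1)]) auto
  qed
  moreover have "form_comp atlas d \<omega> i x = partial i (\<lambda>x. \<psi> (chart_inv d x)) x"
    if d: "d \<in> atlas" and x: "x \<in> chart_image d U" for d x i
  proof -
    let ?D = "frechet_derivative (transition d c) (at x)"
    have x': "x \<in> snd d ` fst d" "chart_inv d x \<in> fst c"
      using x chart_image_iff[OF d] by (auto simp: U_def)
    have y: "transition d c x \<in> snd c ` fst c" and inv: "chart_inv c (transition d c x) = chart_inv d x"
      using x' chart_inv_f[OF c(1)] by auto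
    \<comment> \<open>The chain rule produces the components of the form in \<open>c\<close>,
      contracted with the pushed-forward vector; by linearity and the change of chart for
      \<open>coord_tvec\<close>, this is the component in \<open>d\<close>.\<close>
    have "((\<lambda>x. \<psi> (chart_inv d x)) has_derivative (\<lambda>v. \<Sum>k\<in>UNIV. ?D v $ k * form_comp atlas c \<omega> k (transition d c x))) (at x)"
      unfolding \<psi>_def
      by (rule has_derivative_compose[OF transition_has_derivative[OF d c(1) x'] \<phi>(2)[rule_format, OF B[OF d x]]])
    then have "partial i (\<lambda>x. \<psi> (chart_inv d x)) x =
        (\<Sum>k\<in>UNIV. ?D (axis i 1) $ k * form_comp atlas c \<omega> k (transition d c x))"
      by (rule has_derivative_imp_partial)
    also have "\<dots> = \<omega> (chart_inv d x) (coord_tvec atlas c (transition d c x) (?D (axis i 1)))"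
      using linear_form_components[OF c(1) y, of "\<omega> (chart_inv d x)" "?D (axis i 1)"]
        smooth chart_subset[OF c(1)] x'(2)
      unfolding smooth_one_form_def form_comp_def inv by (simp add: subset_iff)
    also have "\<dots> = form_comp atlas d \<omega> i x"
      unfolding form_comp_def coord_tvec_change_chart[OF c(1) d x', symmetric] ..
    finally show ?thesis ..
  qed
  ultimately have "potential_on atlas U \<omega> \<psi>" unfolding potential_on_def by blast
  moreover have "p \<in> U" using c(2) r(1) by (simp add: U_def)
  ultimately show ?thesis using that U by blast
qed

end

section \<open>The connection of a Berwald-type Kropina metric\<close>

text \<open>Differentiating the horizontal identity in \<open>y\<close> and contracting with \<open>y\<close> expresses the spray of
  \<open>L\<close> through \<open>\<Gamma>\<close>.\<close>

lemma nonlinear_connection_horizontal: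
  fixes L :: "(real ^ 'n::finite) \<times> (real ^ 'n) \<Rightarrow> real" and \<Gamma> :: "'n conn"
  assumes W: "open W" and L: "smooth_on W L"
    and S: "open S" "\<And>z. z \<in> W \<Longrightarrow> fst z \<in> S"
    and \<Gamma>: "\<And>k i j. smooth_on S (\<Gamma> k i j)"
    and sym: "\<And>k i j x. x \<in> S \<Longrightarrow> \<Gamma> k i j x = \<Gamma> k j i x"
    and inv: "\<And>z. z \<in> W \<Longrightarrow> invertible (fundamental_tensor L z)"
    and horizontal: "\<And>z i. z \<in> W \<Longrightarrow>
      partial_x i L z = (\<Sum>l\<in>UNIV. (\<Sum>s\<in>UNIV. \<Gamma> l i s (fst z) * snd z $ s) * partial_y l L z)"
    and z: "z \<in> W"
  shows "nonlinear_connection L j i z = (\<Sum>s\<in>UNIV. \<Gamma> j i s (fst z) * snd z $ s)"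
proof -
  define N where "N = (\<lambda>l i z. \<Sum>s\<in>UNIV. \<Gamma> l i s (fst z) * snd z $ s)"
  have y: "((\<lambda>z. snd z $ s) has_derivative (\<lambda>v. snd v $ s)) (at z)" for s and z :: "(real ^ 'n) \<times> (real ^ 'n)"
    by (intro bounded_linear_imp_has_derivative bounded_linear_compose[OF bounded_linear_vec_nth bounded_linear_snd])
  have y_diff: "(\<lambda>z. snd z $ s) differentiable (at z)" for s and z :: "(real ^ 'n) \<times> (real ^ 'n)"
    using y by (rule differentiableI)
  have y_deriv: "frechet_derivative (\<lambda>z. snd z $ s) (at z) (0, axis k 1) = (if s = k then 1 else 0)"
    for s k and z :: "(real ^ 'n) \<times> (real ^ 'n)"
    using frechet_derivative_at[OF y, of s z, symmetric] by (simp add: axis_def)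
  have x: "((\<lambda>z. \<Gamma> l i s (fst z)) has_derivative (\<lambda>v. frechet_derivative (\<Gamma> l i s) (at (fst z)) (fst v))) (at z)"
    if "z \<in> W" for l i s z
    by (rule has_derivative_compose[OF bounded_linear_imp_has_derivative[OF bounded_linear_fst]
          smooth_on_has_derivative[OF \<Gamma> S(2)[OF that]]])
  have x_diff: "(\<lambda>z. \<Gamma> l i s (fst z)) differentiable (at z)" if "z \<in> W" for l i s z
    using x[OF that] by (rule differentiableI)
  have x_deriv: "frechet_derivative (\<lambda>z. \<Gamma> l i s (fst z)) (at z) (0, axis k 1) = 0" if "z \<in> W" for l i s k z
    using frechet_derivative_at[OF x[OF that], of l i s, symmetric]
      linear_0[OF has_derivative_linear[OF smooth_on_has_derivative[OF \<Gamma> S(2)[OF that]]]] by simp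
  have N_diff: "N l i differentiable (at z)" if "z \<in> W" for l i z
    unfolding N_def[abs_def] by (intro differentiable_sum ballI differentiable_mult x_diff y_diff that) simp
  have N_deriv: "frechet_derivative (N l i) (at z) (0, axis k 1) = \<Gamma> l i k (fst z)" if "z \<in> W" for l i k z
  proof -
    have "frechet_derivative (N l i) (at z) (0, axis k 1) = (\<Sum>s\<in>UNIV. \<Gamma> l i s (fst z) * (if s = k then 1 else 0))"
      unfolding N_def
      by (simp add: frechet_derivative_sum[OF differentiable_mult[OF x_diff[OF that] y_diff]]
          frechet_derivative_mult[OF x_diff[OF that] y_diff] x_deriv[OF that] y_deriv)
    then show ?thesis by (simp add: if_distrib cong: if_cong)
  qed
  have Ly_diff: "partial_y l L differentiable (at z)" if "z \<in> W" for l z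
    unfolding partial_y_def[abs_def] using smooth_on_differentiable[OF smooth_on_derivative[OF L] that] .
  have bracket: "(\<Sum>i\<in>UNIV. snd z $ i * partial_x i (partial_y k L) z) - partial_x k L z =
      (\<Sum>l\<in>UNIV. partial_y k (partial_y l L) z * (\<Sum>i\<in>UNIV. snd z $ i * N l i z))" if z: "z \<in> W" for k z
  proof -
    have "partial_x i (partial_y k L) z = (\<Sum>l\<in>UNIV. N l i z * partial_y k (partial_y l L) z + \<Gamma> l i k (fst z) * partial_y l L z)" for i
    proof -
      \<comment> \<open>Exchanging the derivatives makes the horizontal identity available, which is
        then differentiated in \<open>y\<close>.\<close>
      have "partial_x i (partial_y k L) z = partial_y k (partial_x i L) z"
        unfolding partial_x_def[abs_def] partial_y_def[abs_def] by (rule second_derivative_symmetric[OF W z L])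
      also have "\<dots> = partial_y k (\<lambda>z. \<Sum>l\<in>UNIV. N l i z * partial_y l L z) z"
        unfolding partial_y_def[of k]
        by (subst frechet_derivative_cong[OF W z]) (simp_all add: horizontal N_def)
      also have "\<dots> = (\<Sum>l\<in>UNIV. N l i z * partial_y k (partial_y l L) z + \<Gamma> l i k (fst z) * partial_y l L z)"
        unfolding partial_y_def[of k]
        by (simp add: frechet_derivative_sum[OF differentiable_mult[OF N_diff[OF z] Ly_diff[OF z]]]
            frechet_derivative_mult[OF N_diff[OF z] Ly_diff[OF z]] N_deriv[OF z])
      finally show ?thesis .
    qed
    \<comment> \<open>Symmetry of \<Gamma> moves the contraction to its last index. The second sum
      is then the right-hand side of the horizontal identity, that is, the
      \<open>partial_x k L z\<close> which the bracket subtracts.\<close>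
    then have "(\<Sum>i\<in>UNIV. snd z $ i * partial_x i (partial_y k L) z) =
        (\<Sum>i\<in>UNIV. \<Sum>l\<in>UNIV. partial_y k (partial_y l L) z * (snd z $ i * N l i z))
        + (\<Sum>i\<in>UNIV. \<Sum>l\<in>UNIV. \<Gamma> l k i (fst z) * snd z $ i * partial_y l L z)"
      by (simp add: sum_distrib_left sum.distrib distrib_left sym[OF S(2)[OF z], of _ _ k] mult_ac)
    also have "(\<Sum>i\<in>UNIV. \<Sum>l\<in>UNIV. \<Gamma> l k i (fst z) * snd z $ i * partial_y l L z) = partial_x k L z"
      unfolding horizontal[OF z] sum_distrib_right by (rule sum.swap)
    also have "(\<Sum>i\<in>UNIV. \<Sum>l\<in>UNIV. partial_y k (partial_y l L) z * (snd z $ i * N l i z)) =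
        (\<Sum>l\<in>UNIV. partial_y k (partial_y l L) z * (\<Sum>i\<in>UNIV. snd z $ i * N l i z))"
      unfolding sum_distrib_left by (rule sum.swap)
    finally show ?thesis by simp
  qed
  \<comment> \<open>The factor 2 arises because \<open>fundamental_tensor\<close> is half of the
    Hessian that appears in the bracket.\<close>
  have spray: "(\<Sum>k\<in>UNIV. matrix_inv (fundamental_tensor L z) $ j $ k *
          ((\<Sum>m\<in>UNIV. snd z $ m * partial_x m (partial_y k L) z) - partial_x k L z)) =
      2 * (\<Sum>i\<in>UNIV. snd z $ i * N j i z)" if z: "z \<in> W" for z
  proof -
    let ?v = "\<chi> l. \<Sum>i\<in>UNIV. snd z $ i * N l i z"
    have "(\<Sum>k\<in>UNIV. matrix_inv (fundamental_tensor L z) $ j $ k *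
          ((\<Sum>m\<in>UNIV. snd z $ m * partial_x m (partial_y k L) z) - partial_x k L z)) =
        2 * (matrix_inv (fundamental_tensor L z) *v (fundamental_tensor L z *v ?v)) $ j"
      unfolding bracket[OF z] fundamental_tensor_def matrix_vector_mult_def
      by (simp add: sum_distrib_left mult_ac)
    also have "\<dots> = 2 * ?v $ j"
      by (simp add: matrix_vector_mul_assoc matrix_inv_works[OF inv[OF z]])
    finally show ?thesis by simp
  qed
  have "nonlinear_connection L j i z = 1 / 4 * partial_y i (\<lambda>z. 2 * (\<Sum>r\<in>UNIV. snd z $ r * N j r z)) z"
    unfolding nonlinear_connection_def partial_y_def[of i]
    by (subst frechet_derivative_cong[OF W z spray]) simp_all
  \<comment> \<open>The spray is quadratic in \<open>y\<close>; its two factors contribute equally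
    by symmetry of \<Gamma>. The resulting factor 4 cancels the 1/4 in the definition of the
    connection.\<close>
  also have "partial_y i (\<lambda>z. 2 * (\<Sum>r\<in>UNIV. snd z $ r * N j r z)) z =
      2 * (\<Sum>r\<in>UNIV. snd z $ r * \<Gamma> j r i (fst z) + (if r = i then 1 else 0) * N j r z)"
    unfolding partial_y_def
    by (simp add: frechet_derivative_mult[OF differentiable_const differentiable_sum[OF finite ballI[OF differentiable_mult[OF y_diff N_diff[OF z]]]]]
        frechet_derivative_sum[OF differentiable_mult[OF y_diff N_diff[OF z]]]
        frechet_derivative_mult[OF y_diff N_diff[OF z]] N_deriv[OF z] y_deriv)
  also have "\<dots> = 4 * N j i z"
  proof -
    have "(\<Sum>r\<in>UNIV. snd z $ r * \<Gamma> j r i (fst z)) = N j i z"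
      unfolding N_def by (intro sum.cong refl) (simp add: sym[OF S(2)[OF z], of j _ i])
    moreover have "(\<Sum>r\<in>UNIV. (if r = i then 1 else 0) * N j r z) = (\<Sum>r\<in>UNIV. if r = i then N j r z else 0)"
      by (intro sum.cong refl) simp
    ultimately show ?thesis by (simp add: sum.distrib)
  qed
  finally show ?thesis by (simp add: N_def)
qed

text \<open>The functional vanishes at \<open>y\<close> and at a point shifted along the
  \<open>j\<close>-th axis; the difference of the two values is a nonzero multiple of
  \<open>\<gamma> j\<close>.\<close>

lemma linear_functional_zero_on_open:
  fixes T :: "(real ^ 'n::finite) set" and \<gamma> :: "'n \<Rightarrow> real"
  assumes "open T" "y \<in> T" "\<And>y. y \<in> T \<Longrightarrow> (\<Sum>j\<in>UNIV. \<gamma> j * y $ j) = 0"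
  shows "\<gamma> j = 0"
proof -
  obtain e where e: "e > 0" "cball y e \<subseteq> T" using assms(1,2) open_contains_cball by blast
  have "y + e *\<^sub>R axis j 1 \<in> T" using e by (auto simp: dist_norm norm_axis_1)
  from assms(3)[OF this] have "(\<Sum>j\<in>UNIV. \<gamma> j * y $ j) + (\<Sum>k\<in>UNIV. \<gamma> k * (e * axis j 1 $ k)) = 0"
    by (simp add: distrib_left sum.distrib)
  moreover have "(\<Sum>k\<in>UNIV. \<gamma> k * (e * axis j 1 $ k)) = \<gamma> j * e"
    by (simp add: axis_def if_distrib cong: if_cong)
  ultimately show ?thesis using assms(3)[OF assms(2)] e(1) by simp
qed

lemma ricci_cong:
  assumes "open S" "x \<in> S" "\<And>k i j x. x \<in> S \<Longrightarrow> \<Gamma> k i j x = \<Gamma>' k i j x"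
  shows "ricci \<Gamma> l k x = ricci \<Gamma>' l k x"
proof -
  have "partial p (\<Gamma> k i j) x = partial p (\<Gamma>' k i j) x" for p k i j
    by (rule partial_cong[OF assms(1,2,3)])
  then show ?thesis unfolding ricci_def curvature_def by (simp add: assms(3)[OF assms(2)])
qed

text \<open>For \<open>m = 0\<close>, the square of F is \<bar>A\<bar>, which for an indefinite
  metric need not be a single quadratic form. Splitting \<open>D\<close> by the sign of A gives two
  sets, on which it equals A and -A.\<close>

lemma kropina_0_not_properly_finslerian:
  assumes F: "m_kropina_metric M atlas D 0 a b F"
  shows "\<not> properly_finslerian M atlas D F"
proof -
  define D1 where "D1 = {(p, v) \<in> D. a p v v > 0}"
  define D2 where "D2 = {(p, v) \<in> D. a p v v \<le> 0}"
  have a: "sym_bilinear_form_at atlas p (a p)" if "p \<in> topspace M" for p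
    using F that unfolding m_kropina_metric_def pseudo_riemannian_metric_def by blast
  then have a': "sym_bilinear_form_at atlas p (\<lambda>v w. - a p v w)" if "p \<in> topspace M" for p
    using that unfolding sym_bilinear_form_at_def linear_form_at_def by simp
  have L: "(F (p, v))\<^sup>2 = \<bar>a p v v\<bar>" if "(p, v) \<in> D" for p v
  proof -
    have "F (p, v) = kropina 0 a b (p, v)" "b p v > 0"
      using F that unfolding m_kropina_metric_def kropina_beta_def by auto
    then have "F (p, v) = sqrt \<bar>a p v v\<bar>" by (simp add: kropina_def kropina_alpha_def kropina_beta_def)
    then show ?thesis by simp
  qed
  have "quadratic_on M atlas D1 (\<lambda>z. (F z)\<^sup>2)"
    unfolding quadratic_on_def by (rule exI[of _ a]) (auto simp: a L D1_def)
  moreover have "quadratic_on M atlas D2 (\<lambda>z. (F z)\<^sup>2)"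
    unfolding quadratic_on_def by (rule exI[of _ "\<lambda>p v w. - a p v w"]) (auto simp: a' L D2_def)
  moreover have "\<Union>{D1, D2} = D" by (auto simp: D1_def D2_def)
  ultimately show ?thesis unfolding properly_finslerian_def by (metis finite.emptyI finite.insertI insertE singletonD)
qed

text \<open>The factor of \<open>a\<close> passes through the square root as
  \<open>exp (- m * \<psi> p)\<close>. Raised to the power 1 + m it is inverse to the factor of
  \<open>b\<close> raised to the power -m.\<close>

lemma kropina_rescale:
  fixes s m :: real
  assumes "b p v > 0"
  shows "kropina m (\<lambda>p v w. exp (- 2 * m * \<psi> p) * a p v w) (\<lambda>p v. exp (- (1 + m) * \<psi> p) * b p v) (p, v) =
    kropina m a b (p, v)"
proof -
  have "sqrt (exp (- 2 * m * \<psi> p)) = exp (- m * \<psi> p)"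
    by (rule real_sqrt_unique) (simp_all add: exp_double[symmetric] mult.assoc)
  then have "sqrt \<bar>exp (- 2 * m * \<psi> p) * a p v v\<bar> = exp (- m * \<psi> p) * sqrt \<bar>a p v v\<bar>"
    by (simp add: abs_mult real_sqrt_mult)
  then have "kropina m (\<lambda>p v w. exp (- 2 * m * \<psi> p) * a p v w) (\<lambda>p v. exp (- (1 + m) * \<psi> p) * b p v) (p, v) =
      (exp (- m * \<psi> p) * sqrt \<bar>a p v v\<bar>) powr (1 + m) * (exp (- (1 + m) * \<psi> p) * b p v) powr (- m)"
    by (simp only: kropina_def kropina_alpha_def kropina_beta_def case_prod_conv)
  also have "\<dots> = (exp (- m * \<psi> p * (1 + m)) * exp (- (1 + m) * \<psi> p * (- m))) * kropina m a b (p, v)"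
    using assms by (simp add: powr_mult exp_powr_real kropina_def kropina_alpha_def kropina_beta_def)
  also have "exp (- m * \<psi> p * (1 + m)) * exp (- (1 + m) * \<psi> p * (- m)) = 1"
    by (simp add: exp_add[symmetric] algebra_simps)
  finally show ?thesis by simp
qed

context manifold
begin

text \<open>Both families of coefficients represent the same nonlinear connection, so their
  difference annihilates all \<open>y\<close> in the fibre of \<open>D\<close> over the point. That
  fibre is open, and nonempty since \<open>D\<close> projects onto the manifold.\<close>

lemma affine_connection_eq:
  assumes D: "conic_subbundle M atlas D" and \<Gamma>: "berwald_coeffs atlas D F \<Gamma>"
    and c: "c \<in> atlas" and x: "x \<in> snd c ` fst c"
  shows "affine_connection atlas D F c k i j x = \<Gamma> c k i j x"
proof -
  have aff: "berwald_coeffs atlas D F (affine_connection atlas D F)"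
    unfolding affine_connection_def by (rule someI[of "berwald_coeffs atlas D F", OF \<Gamma>])
  have key: "nonlinear_connection (coord_L atlas c F) k i (x, y) = (\<Sum>j\<in>UNIV. \<Delta> c k i j x * y $ j)"
    if "berwald_coeffs atlas D F \<Delta>" "(x, y) \<in> coord_dom atlas c D" for \<Delta> y
    using bspec[OF bspec[OF that(1)[unfolded berwald_coeffs_def] c] that(2)] by simp
  let ?T = "{y. (x, y) \<in> coord_dom atlas c D}"
  have "open (coord_dom atlas c D)" using D c unfolding conic_subbundle_def by blast
  then have "open (Pair x -` coord_dom atlas c D)"
    by (rule open_vimage) (intro continuous_intros)
  then have T: "open ?T" by (simp add: vimage_def)
  have "chart_inv c x \<in> fst ` D"
    using D chart_inv_in[OF x] chart_subset[OF c] unfolding conic_subbundle_def by blast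
  then obtain v where v: "(chart_inv c x, v) \<in> D" by auto
  then have "v \<in> tangent_space atlas (chart_inv c x)"
    using D unfolding conic_subbundle_def by blast
  from tangent_vector_eq_coord_tvec[OF c chart_inv_in[OF x] this]
  have vc: "v c \<in> ?T" using v x by (simp add: coord_dom_def coord_pt_def chart_f_inv[OF x])
  have "(\<Sum>j\<in>UNIV. (affine_connection atlas D F c k i j x - \<Gamma> c k i j x) * y $ j) = 0" if "y \<in> ?T" for y
  proof -
    have y: "(x, y) \<in> coord_dom atlas c D" using that by simp
    show ?thesis
      unfolding left_diff_distrib sum_subtractf key[OF aff y, symmetric] key[OF \<Gamma> y, symmetric] by simp
  qed
  from linear_functional_zero_on_open[OF T vc this]
  have "affine_connection atlas D F c k i j x - \<Gamma> c k i j x = 0" .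
  then show ?thesis by simp
qed

lemma chart_image_topspace: "c \<in> atlas \<Longrightarrow> chart_image c (topspace M) = snd c ` fst c"
  using chart_subset by (simp add: inf.absorb1)

lemma kropina_berwald_equation_weyl:
  assumes a: "pseudo_riemannian_metric atlas (topspace M) a"
    and f: "smooth_vector_field atlas (topspace M) f"
    and eq: "kropina_berwald_equation atlas (topspace M) m a b f"
    and c: "c \<in> atlas" and x: "x \<in> chart_image c (topspace M)"
  shows "partial j (form_comp atlas c b i) x
      - (\<Sum>k\<in>UNIV. weyl_conn m (metric_matrix a c) (form_comp atlas c (lower a f)) k j i x * form_comp atlas c b k x)
    = (1 + m) * form_comp atlas c b i x * form_comp atlas c (lower a f) j x"
proof -
  let ?g = "metric_matrix a c"
  let ?f = "form_comp atlas c (lower a f)"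
  let ?b = "form_comp atlas c b"
  interpret weyl_coordinates "chart_image c (topspace M)" m ?g ?f
    by (rule weyl_coordinates_chart[OF openin_topspace a c smooth_form_comp_lower[OF openin_topspace a c f]])
  show ?thesis
  proof (rule weyl_conn_one_form[OF x])
    have "cov_deriv atlas c (levi_civita atlas a c) b j i x =
        m * (\<Sum>k\<in>UNIV. ?f k x * raised_comp atlas c a b k x) * tensor_comp atlas c a i j x
        + ?b i x * ?f j x - m * ?f i x * ?b j x"
      using eq c x unfolding kropina_berwald_equation_def by blast
    then show "partial j (?b i) x - (\<Sum>k\<in>UNIV. weyl_conn 0 ?g ?f k j i x * ?b k x) =
        m * (\<Sum>k\<in>UNIV. ?f k x * (\<Sum>l\<in>UNIV. matrix_inv (?g x) $ k $ l * ?b l x)) * ?g x $ i $ j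
        + ?b i x * ?f j x - m * ?f i x * ?b j x"
      unfolding cov_deriv_def raised_comp_def metric_inv_def levi_civita_eq_weyl_conn[of a c _ _ _ _ ?f]
      by (simp add: metric_matrix_def)
  qed
qed

text \<open>Identifies the affine connection from the equation for \<open>f\<close>. It remains to
  verify the hypothesis of \<open>nonlinear_connection_horizontal\<close>, for which L is written as
  the exponential of a combination of logarithms of A and \<beta>.\<close>

lemma kropina_berwald_coeffs:
  assumes F: "m_kropina_metric M atlas D m a b F"
    and f: "smooth_vector_field atlas (topspace M) f"
    and eq: "kropina_berwald_equation atlas (topspace M) m a b f"
  shows "berwald_coeffs atlas D F (\<lambda>c. weyl_conn m (metric_matrix a c) (form_comp atlas c (lower a f)))"
  unfolding berwald_coeffs_def
proof (intro ballI, clarify)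
  fix c x0 y0 k i assume c: "(c :: ('p, 'n) chart) \<in> atlas" and z0: "(x0, y0) \<in> coord_dom atlas c D"
  have a: "pseudo_riemannian_metric atlas (topspace M) a" and b: "smooth_one_form atlas (topspace M) b"
    and fin: "finsler_metric M atlas D F"
    and FD: "\<And>z. z \<in> D \<Longrightarrow> kropina_alpha a z \<noteq> 0 \<and> kropina_beta b z > 0 \<and> F z = kropina m a b z"
    using F unfolding m_kropina_metric_def by blast+
  let ?S = "chart_image c (topspace M)"
  let ?W = "coord_dom atlas c D"
  let ?g = "metric_matrix a c"
  let ?f = "form_comp atlas c (lower a f)"
  let ?b = "form_comp atlas c b"
  let ?\<Gamma> = "weyl_conn m ?g ?f"
  let ?L = "coord_L atlas c F"
  interpret weyl_coordinates ?S m ?g ?f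
    by (rule weyl_coordinates_chart[OF openin_topspace a c smooth_form_comp_lower[OF openin_topspace a c f]])
  have W: "open ?W" using fin c unfolding finsler_metric_def conic_subbundle_def by blast
  have W_S: "fst z \<in> ?S" if "z \<in> ?W" for z
    using that chart_image_topspace[OF c] by (simp add: coord_dom_def)
  have L: "smooth_on ?W ?L"
  proof -
    have "smooth_on ?W (\<lambda>z. F (coord_pt atlas c z) * F (coord_pt atlas c z))"
      using fin c unfolding finsler_metric_def by (intro smooth_on_mult W) blast+
    then show ?thesis unfolding coord_L_def[abs_def] power2_eq_square .
  qed
  have smooth_b: "smooth_on ?S (?b i)" for i
    using b c unfolding smooth_one_form_def by blast
  define A where "A = (\<lambda>z. \<Sum>r\<in>UNIV. \<Sum>s\<in>UNIV. ?g (fst z) $ r $ s * (snd z $ r * snd z $ s))"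
  define B where "B = (\<lambda>z. \<Sum>r\<in>UNIV. snd z $ r * ?b r (fst z))"
  \<comment> \<open>\<open>A\<close> may be negative: \<open>ln (A\<^sup>2)\<close> is differentiable without a case distinction on its sign.\<close>
  have kropina: "A z \<noteq> 0 \<and> B z > 0 \<and> ?L z = exp ((1 + m) / 2 * ln ((A z)\<^sup>2) - 2 * m * ln (B z))"
    if z: "z \<in> ?W" for z
  proof -
    obtain x y where xy: "z = (x, y)" by (cases z)
    let ?p = "chart_inv c x" and ?v = "coord_tvec atlas c x y"
    have x: "x \<in> ?S" "x \<in> snd c ` fst c" using W_S[OF z] by (auto simp: xy)
    have pv: "(?p, ?v) \<in> D" using z by (simp add: xy coord_dom_def coord_pt_def)
    have "linear_form_at atlas ?p (b ?p)"
      using b x(1) unfolding smooth_one_form_def chart_image_iff[OF c] by blast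
    from linear_form_components[OF c x(2) this, of y] have Bz: "B z = b ?p ?v"
      by (simp add: B_def xy form_comp_def)
    have Az: "A z = a ?p ?v ?v"
      using metric_components[OF openin_topspace a c x(1), of y y] by (simp add: A_def xy)
    have A0: "A z \<noteq> 0" and B0: "B z > 0" and Fz: "F (?p, ?v) = kropina m a b (?p, ?v)"
      using FD[OF pv] by (auto simp: kropina_alpha_def kropina_beta_def Az Bz)
    \<comment> \<open>The logarithm of \<alpha> becomes a quarter of that of the square of A: one
      half from the root and one half from the squaring.\<close>
    have "ln ((A z)\<^sup>2) = 2 * ln \<bar>A z\<bar>"
      using A0 ln_realpow[of "\<bar>A z\<bar>" 2] by simp
    moreover have "ln (sqrt \<bar>A z\<bar>) = ln \<bar>A z\<bar> / 2"
      using A0 by (simp add: ln_sqrt)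
    ultimately have ln_sqrt_A: "ln (sqrt \<bar>A z\<bar>) = ln ((A z)\<^sup>2) / 4" by simp
    have "F (?p, ?v) = sqrt \<bar>A z\<bar> powr (1 + m) * B z powr (- m)"
      unfolding Fz kropina_def kropina_alpha_def kropina_beta_def case_prod_conv Az Bz ..
    also have "\<dots> = exp ((1 + m) * ln (sqrt \<bar>A z\<bar>) + - m * ln (B z))"
      using A0 B0 unfolding exp_add by (simp only: powr_def real_sqrt_eq_0_iff abs_eq_0 if_False) simp
    also have "\<dots> = exp ((1 + m) / 4 * ln ((A z)\<^sup>2) - m * ln (B z))"
      unfolding ln_sqrt_A by simp
    finally have "F (?p, ?v) = exp ((1 + m) / 4 * ln ((A z)\<^sup>2) - m * ln (B z))" .
    then have "?L z = exp (2 * ((1 + m) / 4 * ln ((A z)\<^sup>2) - m * ln (B z)))"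
      by (simp only: coord_L_def coord_pt_def xy case_prod_conv exp_double)
    also have "2 * ((1 + m) / 4 * ln ((A z)\<^sup>2) - m * ln (B z)) = (1 + m) / 2 * ln ((A z)\<^sup>2) - 2 * m * ln (B z)"
      by (simp add: field_simps)
    finally show ?thesis using A0 B0 by blast
  qed
  have horizontal: "partial_x i ?L z = (\<Sum>l\<in>UNIV. (\<Sum>s\<in>UNIV. ?\<Gamma> l i s (fst z) * snd z $ s) * partial_y l ?L z)"
    if z: "z \<in> ?W" for z i
  proof -
    obtain x y where xy: "z = (x, y)" by (cases z)
    have x: "x \<in> ?S" using W_S[OF z] by (simp add: xy)
    define N where "N = (\<chi> l. \<Sum>s\<in>UNIV. ?\<Gamma> l i s x * y $ s)"
    \<comment> \<open>This is the horizontal lift of the \<open>i\<close>-th coordinate vector for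
      \<Gamma>. The claimed identity says that L has derivative 0 in this direction.\<close>
    let ?h = "(axis i 1 :: real ^ 'n, - N)"
    have dy: "((\<lambda>z. snd z $ s) has_derivative (\<lambda>v. snd v $ s)) (at z)" for s
      by (intro bounded_linear_imp_has_derivative bounded_linear_compose[OF bounded_linear_vec_nth bounded_linear_snd])
    have dx: "((\<lambda>z. h (fst z)) has_derivative (\<lambda>v. frechet_derivative h (at (fst z)) (fst v))) (at z)"
      if "smooth_on ?S h" for h :: "real ^ 'n \<Rightarrow> real"
      by (rule has_derivative_compose[OF bounded_linear_imp_has_derivative[OF bounded_linear_fst]
          smooth_on_has_derivative[OF that W_S[OF z]]])
    define A' where "A' = (\<lambda>v. \<Sum>r\<in>UNIV. \<Sum>s\<in>UNIV.
      ?g (fst z) $ r $ s * (snd z $ r * snd v $ s + snd v $ r * snd z $ s)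
      + frechet_derivative (\<lambda>x. ?g x $ r $ s) (at (fst z)) (fst v) * (snd z $ r * snd z $ s))"
    have A': "(A has_derivative A') (at z)"
      unfolding A_def A'_def
      by (intro has_derivative_sum has_derivative_mult dx[OF smooth_g] dy)
    define B' where "B' = (\<lambda>v. \<Sum>r\<in>UNIV.
      snd z $ r * frechet_derivative (?b r) (at (fst z)) (fst v) + snd v $ r * ?b r (fst z))"
    have B': "(B has_derivative B') (at z)"
      unfolding B_def B'_def
      by (intro has_derivative_sum has_derivative_mult dx[OF smooth_b] dy)
    have "A' ?h = (\<Sum>r\<in>UNIV. \<Sum>s\<in>UNIV. partial i (\<lambda>x. ?g x $ r $ s) x * (y $ r * y $ s))
      - ((\<Sum>r\<in>UNIV. \<Sum>s\<in>UNIV. ?g x $ r $ s * (y $ r * N $ s)) + (\<Sum>r\<in>UNIV. \<Sum>s\<in>UNIV. ?g x $ r $ s * (N $ r * y $ s)))"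
      by (simp add: A'_def xy partial_def algebra_simps sum.distrib sum_subtractf sum_negf)
    also have "(\<Sum>r\<in>UNIV. \<Sum>s\<in>UNIV. ?g x $ r $ s * (y $ r * N $ s)) = (\<Sum>r\<in>UNIV. \<Sum>s\<in>UNIV. ?g x $ r $ s * (N $ r * y $ s))"
      by (subst sum.swap) (simp add: sym_g[OF x] mult_ac)
    also have "(\<Sum>r\<in>UNIV. \<Sum>s\<in>UNIV. ?g x $ r $ s * (N $ r * y $ s)) = (\<Sum>l\<in>UNIV. N $ l * (\<Sum>r\<in>UNIV. ?g x $ l $ r * y $ r))"
      by (simp add: sum_distrib_left mult_ac)
    finally have Ah: "A' ?h = 2 * m * ?f i x * A z"
      using weyl_conn_metric[OF x, of i y] by (simp add: N_def A_def xy)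
    have "partial i (?b j) x - (\<Sum>k\<in>UNIV. ?\<Gamma> k i j x * ?b k x) = (1 + m) * ?b j x * ?f i x" for j
      by (rule kropina_berwald_equation_weyl[OF a f eq c x])
    then have nabla_b: "partial i (?b j) x = (1 + m) * ?b j x * ?f i x + (\<Sum>k\<in>UNIV. ?\<Gamma> k i j x * ?b k x)" for j
      by (simp add: algebra_simps)
    have "B' ?h = (\<Sum>j\<in>UNIV. y $ j * partial i (?b j) x) - (\<Sum>k\<in>UNIV. N $ k * ?b k x)"
      by (simp add: B'_def xy partial_def sum_subtractf)
    also have "(\<Sum>k\<in>UNIV. N $ k * ?b k x) = (\<Sum>j\<in>UNIV. y $ j * (\<Sum>k\<in>UNIV. ?\<Gamma> k i j x * ?b k x))"
      unfolding N_def vec_lambda_beta sum_distrib_left sum_distrib_right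
      by (subst sum.swap) (simp add: mult_ac)
    also have "(\<Sum>j\<in>UNIV. y $ j * partial i (?b j) x) - \<dots> = (1 + m) * ?f i x * B z"
      unfolding nabla_b by (simp add: B_def xy sum_distrib_left sum_subtractf[symmetric] sum.distrib algebra_simps)
    finally have Bh: "B' ?h = (1 + m) * ?f i x * B z" .
    have square_pos: "0 < t * t" if "t \<noteq> 0" for t :: real
      using that not_real_square_gt_zero[of t] by blast
    have "((\<lambda>z. exp ((1 + m) / 2 * ln ((A z)\<^sup>2) - 2 * m * ln (B z))) has_derivative
        (\<lambda>v. ?L z * ((1 + m) / 2 * (2 * A z * A' v / (A z)\<^sup>2) - 2 * m * (B' v / B z)))) (at z)"
      using kropina[OF z]
      by (auto intro!: derivative_eq_intros A' B' square_pos simp: fun_eq_iff field_simps power2_eq_square)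
    then have dL: "(?L has_derivative (\<lambda>v. ?L z * ((1 + m) / 2 * (2 * A z * A' v / (A z)\<^sup>2) - 2 * m * (B' v / B z)))) (at z)"
      by (rule has_derivative_transform_within_open[OF _ W z]) (simp add: kropina)
    have "frechet_derivative ?L (at z) ?h = 0"
      unfolding frechet_derivative_at[OF dL, symmetric] Ah Bh
      using kropina[OF z] by (simp add: power2_eq_square)
    moreover have "frechet_derivative ?L (at z) ?h = partial_x i ?L z - (\<Sum>l\<in>UNIV. N $ l * partial_y l ?L z)"
    proof -
      interpret DL: linear "frechet_derivative ?L (at z)"
        by (rule has_derivative_linear[OF smooth_on_has_derivative[OF L z]])
      have "linear (\<lambda>w. frechet_derivative ?L (at z) (0, w))"
      proof (rule linearI)
        show "frechet_derivative ?L (at z) (0, v + w) = frechet_derivative ?L (at z) (0, v) + frechet_derivative ?L (at z) (0, w)" for v w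
          using DL.add[of "(0, v)" "(0, w)"] by simp
        show "frechet_derivative ?L (at z) (0, r *\<^sub>R w) = r *\<^sub>R frechet_derivative ?L (at z) (0, w)" for r w
          using DL.scale[of r "(0, w)"] by simp
      qed
      from linear_sum_axis[OF this, of N]
      have "frechet_derivative ?L (at z) (0, N) = (\<Sum>l\<in>UNIV. N $ l * partial_y l ?L z)"
        by (simp add: partial_y_def)
      moreover have "?h = (axis i 1, 0) - (0, N)" by (simp add: minus_prod_def)
      ultimately show ?thesis unfolding partial_x_def by (simp only: DL.diff)
    qed
    ultimately show ?thesis by (simp add: N_def xy)
  qed
  have inv: "invertible (fundamental_tensor ?L z)" if "z \<in> ?W" for z
    using fin c that unfolding finsler_metric_def by blast
  show "nonlinear_connection ?L k i (x0, y0) = (\<Sum>j\<in>UNIV. ?\<Gamma> k i j x0 * y0 $ j)"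
    using nonlinear_connection_horizontal[OF W L open_S W_S smooth_weyl_conn weyl_conn_sym inv horizontal z0]
    by simp
qed

end

section \<open>Local metrizability\<close>

context manifold
begin

lemma pseudo_riemannian_metric_subset:
  assumes a: "pseudo_riemannian_metric atlas (topspace M) a" and U: "openin M U"
  shows "pseudo_riemannian_metric atlas U a"
proof -
  have "U \<subseteq> topspace M" using U openin_subset by blast
  then have "chart_image c U \<subseteq> chart_image c (topspace M)" for c :: "('p, 'n) chart" by blast
  then show ?thesis
    using a \<open>U \<subseteq> topspace M\<close> unfolding pseudo_riemannian_metric_def
    by (blast intro: smooth_on_subset)
qed

lemma smooth_vector_field_subset:
  assumes f: "smooth_vector_field atlas (topspace M) f" and U: "openin M U"
  shows "smooth_vector_field atlas U f"
proof -
  have "U \<subseteq> topspace M" using U openin_subset by blast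
  then have "chart_image c U \<subseteq> chart_image c (topspace M)" for c :: "('p, 'n) chart" by blast
  then show ?thesis
    using f \<open>U \<subseteq> topspace M\<close> unfolding smooth_vector_field_def by (blast intro: smooth_on_subset)
qed

text \<open>A Levi-Civita connection is the case \<open>m = 0\<close> of \<open>weyl_conn\<close>,
  in which the right-hand side of \<open>ricci_weyl_conn\<close> vanishes.\<close>

lemma levi_civita_ricci_symmetric:
  assumes U: "openin M U" and h: "pseudo_riemannian_metric atlas U h"
    and c: "c \<in> atlas" and x: "x \<in> chart_image c U"
  shows "ricci (levi_civita atlas h c) i j x = ricci (levi_civita atlas h c) j i x"
proof -
  interpret weyl_coordinates "chart_image c U" 0 "metric_matrix h c" "\<lambda>_ _. 0"
    by (rule weyl_coordinates_chart[OF U h c smooth_on_const])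
  have "ricci (levi_civita atlas h c) i j x = ricci (weyl_conn 0 (metric_matrix h c) (\<lambda>_ _. 0)) i j x" for i j
    by (rule ricci_cong[OF open_S x levi_civita_eq_weyl_conn])
  then show ?thesis using ricci_weyl_conn[OF x, of i j] by simp
qed

text \<open>The Ricci tensor at a point depends only on the connection near that point, so a metric
  on a neighbourhood suffices.\<close>

lemma locally_metrizable_imp_ricci_symmetric:
  assumes "locally_metrizable M atlas D F"
  shows "affine_ricci_symmetric atlas D F"
  unfolding affine_ricci_symmetric_def
proof (intro ballI allI)
  fix c x i j assume c: "(c :: ('p, 'n) chart) \<in> atlas" and x: "x \<in> snd c ` fst c"
  have "chart_inv c x \<in> topspace M" using chart_inv_in[OF x] chart_subset[OF c] by blast
  then obtain U h where U: "openin M U" "chart_inv c x \<in> U" and h: "metrizes_on atlas D F U h"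
    using assms unfolding locally_metrizable_def by blast
  have xU: "x \<in> chart_image c U" using x U(2) chart_image_iff[OF c] by blast
  have "affine_connection atlas D F c k i j y = levi_civita atlas h c k i j y" if "y \<in> chart_image c U" for k i j y
    using h c that unfolding metrizes_on_def by (blast intro: sym)
  from ricci_cong[OF open_chart_image[OF c U(1)] xU this]
  have ric: "ricci (affine_connection atlas D F c) i j x = ricci (levi_civita atlas h c) i j x" for i j .
  have "pseudo_riemannian_metric atlas U h" using h unfolding metrizes_on_def by blast
  from levi_civita_ricci_symmetric[OF U(1) this c xU]
  show "ricci (affine_connection atlas D F c) i j x = ricci (affine_connection atlas D F c) j i x"
    unfolding ric .
qed

lemma potential_smooth:
  assumes "potential_on atlas U \<omega> \<psi>" "c \<in> atlas"
  shows "smooth_on (chart_image c U) (\<lambda>x. \<psi> (chart_inv c x))"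
  using assms unfolding potential_on_def smooth_function_on_def by blast

lemma metric_matrix_conformal:
  "metric_matrix (\<lambda>p v w. exp (- 2 * m * \<psi> p) * a p v w) c =
    (\<lambda>x. exp (- 2 * m * \<psi> (chart_inv c x)) *\<^sub>R metric_matrix a c x)"
  by (simp add: fun_eq_iff vec_eq_iff metric_matrix_def tensor_comp_def)

lemma pseudo_riemannian_metric_conformal:
  assumes a: "pseudo_riemannian_metric atlas U a" and U: "openin M U"
    and \<psi>: "\<And>c. c \<in> atlas \<Longrightarrow> smooth_on (chart_image c U) (\<lambda>x. \<psi> (chart_inv c x))"
  shows "pseudo_riemannian_metric atlas U (\<lambda>p v w. exp (- 2 * m * \<psi> p) * a p v w)"
  unfolding pseudo_riemannian_metric_def
proof (intro conjI ballI allI impI)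
  fix p assume p: "p \<in> U"
  have "sym_bilinear_form_at atlas p (a p)"
    using a p unfolding pseudo_riemannian_metric_def by blast
  then show "sym_bilinear_form_at atlas p (\<lambda>v w. exp (- 2 * m * \<psi> p) * a p v w)"
    unfolding sym_bilinear_form_at_def linear_form_at_def by (simp add: algebra_simps)
  fix v assume v: "v \<in> tangent_space atlas p" "\<forall>w\<in>tangent_space atlas p. exp (- 2 * m * \<psi> p) * a p v w = 0"
  then have "\<forall>w\<in>tangent_space atlas p. a p v w = 0" by simp
  then show "v = (\<lambda>_. 0)" using a p v(1) unfolding pseudo_riemannian_metric_def by blast
next
  fix c i j assume c: "(c :: ('p, 'n) chart) \<in> atlas"
  have "smooth_on (chart_image c U) (\<lambda>x. exp (- 2 * m * \<psi> (chart_inv c x)) * tensor_comp atlas c a i j x)"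
    using a c \<psi>[OF c] unfolding pseudo_riemannian_metric_def
    by (intro smooth_on_mult smooth_on_exp smooth_on_const open_chart_image c U) blast+
  then show "smooth_on (chart_image c U) (tensor_comp atlas c (\<lambda>p v w. exp (- 2 * m * \<psi> p) * a p v w) i j)"
    unfolding tensor_comp_def[abs_def] .
qed

lemma levi_civita_conformal:
  assumes a: "pseudo_riemannian_metric atlas U a" and U: "openin M U"
    and f: "smooth_vector_field atlas U f" and \<psi>: "potential_on atlas U (lower a f) \<psi>"
    and c: "c \<in> atlas" and x: "x \<in> chart_image c U"
  shows "levi_civita atlas (\<lambda>p v w. exp (- 2 * m * \<psi> p) * a p v w) c k i j x =
    weyl_conn m (metric_matrix a c) (form_comp atlas c (lower a f)) k i j x"
proof -
  interpret weyl_coordinates "chart_image c U" m "metric_matrix a c" "form_comp atlas c (lower a f)"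
    by (rule weyl_coordinates_chart[OF U a c smooth_form_comp_lower[OF U a c f]])
  have "form_comp atlas c (lower a f) i x = partial i (\<lambda>x. \<psi> (chart_inv c x)) x" for i
    using \<psi> c x unfolding potential_on_def by blast
  from weyl_conn_conformal[OF x potential_smooth[OF \<psi> c] this]
  show ?thesis
    unfolding levi_civita_eq_weyl_conn[of _ _ _ _ _ _ "\<lambda>_ _. 0"] metric_matrix_conformal .
qed

lemma smooth_one_form_rescale:
  assumes b: "smooth_one_form atlas (topspace M) b" and U: "openin M U"
    and \<psi>: "\<And>c. c \<in> atlas \<Longrightarrow> smooth_on (chart_image c U) (\<lambda>x. \<psi> (chart_inv c x))"
  shows "smooth_one_form atlas U (\<lambda>p v. exp (r * \<psi> p) * b p v)"
  unfolding smooth_one_form_def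
proof (intro conjI ballI allI)
  have sub: "U \<subseteq> topspace M" using U openin_subset by blast
  fix p assume "p \<in> U"
  then have "linear_form_at atlas p (b p)"
    using b sub unfolding smooth_one_form_def by blast
  then show "linear_form_at atlas p (\<lambda>v. exp (r * \<psi> p) * b p v)"
    unfolding linear_form_at_def by (simp add: algebra_simps)
next
  fix c i assume c: "(c :: ('p, 'n) chart) \<in> atlas"
  have "chart_image c U \<subseteq> chart_image c (topspace M)" using U openin_subset by blast
  then have "smooth_on (chart_image c U) (form_comp atlas c b i)"
    using b c smooth_on_subset unfolding smooth_one_form_def by blast
  then have "smooth_on (chart_image c U) (\<lambda>x. exp (r * \<psi> (chart_inv c x)) * form_comp atlas c b i x)"
    by (intro smooth_on_mult smooth_on_exp smooth_on_const open_chart_image c U \<psi>)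
  then show "smooth_on (chart_image c U) (form_comp atlas c (\<lambda>p v. exp (r * \<psi> p) * b p v) i)"
    unfolding form_comp_def[abs_def] .
qed

text \<open>The Levi-Civita connection of the rescaled metric is \<Gamma>, with respect to which the
  derivative of \<open>b\<close> is (1 + m)f \<otimes> b. The derivative of the factor contributes
  -(1 + m)f and cancels it.\<close>

lemma rescaled_one_form_covariantly_constant:
  assumes a: "pseudo_riemannian_metric atlas (topspace M) a" and b: "smooth_one_form atlas (topspace M) b"
    and f: "smooth_vector_field atlas (topspace M) f"
    and eq: "kropina_berwald_equation atlas (topspace M) m a b f"
    and U: "openin M U" and \<psi>: "potential_on atlas U (lower a f) \<psi>"
  shows "covariantly_constant atlas U (\<lambda>p v w. exp (- 2 * m * \<psi> p) * a p v w) (\<lambda>p v. exp (- (1 + m) * \<psi> p) * b p v)"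
  unfolding covariantly_constant_def
proof (intro ballI allI)
  fix c x i j assume c: "(c :: ('p, 'n) chart) \<in> atlas" and x: "x \<in> chart_image c U"
  let ?S = "chart_image c (topspace M)"
  let ?g = "metric_matrix a c"
  let ?f = "form_comp atlas c (lower a f)"
  let ?b = "form_comp atlas c b"
  let ?E = "\<lambda>x. exp (- (1 + m) * \<psi> (chart_inv c x))"
  have sub: "U \<subseteq> topspace M" using U openin_subset by blast
  then have xS: "x \<in> ?S" using x by blast
  have aU: "pseudo_riemannian_metric atlas U a" by (rule pseudo_riemannian_metric_subset[OF a U])
  have fU: "smooth_vector_field atlas U f" by (rule smooth_vector_field_subset[OF f U])
  have "partial j (?b i) x - (\<Sum>k\<in>UNIV. weyl_conn m ?g ?f k j i x * ?b k x) = (1 + m) * ?b i x * ?f j x"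
    by (rule kropina_berwald_equation_weyl[OF a f eq c xS])
  then have db: "partial j (?b i) x = (\<Sum>k\<in>UNIV. weyl_conn m ?g ?f k j i x * ?b k x) + (1 + m) * ?b i x * ?f j x"
    by simp
  have "((\<lambda>x. \<psi> (chart_inv c x)) has_derivative frechet_derivative (\<lambda>x. \<psi> (chart_inv c x)) (at x)) (at x)"
    by (rule smooth_on_has_derivative[OF potential_smooth[OF \<psi> c] x])
  then have "(?E has_derivative (\<lambda>v. ?E x * (- (1 + m) * frechet_derivative (\<lambda>x. \<psi> (chart_inv c x)) (at x) v))) (at x)"
    by (auto intro!: derivative_eq_intros)
  then have dE: "partial j ?E x = ?E x * (- (1 + m) * partial j (\<lambda>x. \<psi> (chart_inv c x)) x)" and E: "?E differentiable (at x)"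
    unfolding partial_def[of j "\<lambda>x. \<psi> (chart_inv c x)"]
    by (auto dest: has_derivative_imp_partial intro: differentiableI)
  have f_eq: "?f j x = partial j (\<lambda>x. \<psi> (chart_inv c x)) x"
    using \<psi> c x unfolding potential_on_def by blast
  have b_diff: "?b i differentiable (at x)"
    by (rule smooth_on_differentiable[OF _ xS]) (use b c in \<open>auto simp: smooth_one_form_def\<close>)
  have comp: "form_comp atlas c (\<lambda>p v. exp (- (1 + m) * \<psi> p) * b p v) k = (\<lambda>x. ?E x * ?b k x)" for k
    by (simp add: form_comp_def fun_eq_iff)
  have "partial j (\<lambda>x. ?E x * ?b i x) x = ?E x * (\<Sum>k\<in>UNIV. weyl_conn m ?g ?f k j i x * ?b k x)"
    unfolding partial_mult[OF E b_diff] dE f_eq[symmetric] db by (simp add: algebra_simps)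
  also have "\<dots> = (\<Sum>k\<in>UNIV. weyl_conn m ?g ?f k j i x * (?E x * ?b k x))"
    by (simp add: sum_distrib_left mult_ac)
  finally show "cov_deriv atlas c (levi_civita atlas (\<lambda>p v w. exp (- 2 * m * \<psi> p) * a p v w) c)
      (\<lambda>p v. exp (- (1 + m) * \<psi> p) * b p v) j i x = 0"
    unfolding cov_deriv_def comp levi_civita_conformal[OF aU U fU \<psi> c x] by simp
qed

end

theorem theorem6p3p2:
  fixes M :: "'p topology"
    and atlas :: "('p, 'n::finite) chart set"
    and D :: "('p \<times> ('p, 'n) tvec) set"
    and F :: "'p \<times> ('p, 'n) tvec \<Rightarrow> real"
    and m :: real
    and a :: "('p, 'n) two_tensor"
    and b :: "('p, 'n) one_form"
    and f :: "('p, 'n) vector_field"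
  assumes "smooth_manifold M atlas"
    and "CARD('n) > 2"
    and "m_kropina_metric M atlas D m a b F"
    and "properly_finslerian M atlas D F"
    and "berwald_type atlas D F"
    and "smooth_vector_field atlas (topspace M) f"
    and "kropina_berwald_equation atlas (topspace M) m a b f"
  shows "(locally_metrizable M atlas D F \<longleftrightarrow> affine_ricci_symmetric atlas D F) \<and>
    (affine_ricci_symmetric atlas D F \<longleftrightarrow> closed_one_form atlas (topspace M) (lower a f)) \<and>
    (closed_one_form atlas (topspace M) (lower a f) \<longrightarrow>
      (\<forall>p\<in>topspace M. \<exists>U \<psi>. openin M U \<and> p \<in> U \<and> potential_on atlas U (lower a f) \<psi>) \<and>
      (\<forall>U \<psi>. openin M U \<and> potential_on atlas U (lower a f) \<psi> \<longrightarrow>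
        (let a' = (\<lambda>p v w. exp (- 2 * m * \<psi> p) * a p v w);
             b' = (\<lambda>p v. exp (- (1 + m) * \<psi> p) * b p v)
         in (\<forall>(p, v)\<in>D. p \<in> U \<longrightarrow> F (p, v) = kropina m a' b' (p, v)) \<and>
            smooth_one_form atlas U b' \<and>
            covariantly_constant atlas U a' b' \<and>
            metrizes_on atlas D F U a')))"
proof -
  interpret manifold M atlas by unfold_locales (rule assms(1))
  note F = assms(3) and f = assms(6) and eq = assms(7)
  have a: "pseudo_riemannian_metric atlas (topspace M) a" and b: "smooth_one_form atlas (topspace M) b"
    and D: "conic_subbundle M atlas D"
    using F unfolding m_kropina_metric_def finsler_metric_def by blast+
  have F_eq: "F z = kropina m a b z" "kropina_beta b z > 0" if "z \<in> D" for z
    using F that unfolding m_kropina_metric_def by blast+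
  have "m \<noteq> 0" using kropina_0_not_properly_finslerian F assms(4) by blast
  have f_smooth: "smooth_on (chart_image c (topspace M)) (form_comp atlas c (lower a f) i)" if "c \<in> atlas" for c i
    by (rule smooth_form_comp_lower[OF openin_topspace a that f])
  have aff: "affine_connection atlas D F c k i j x =
      weyl_conn m (metric_matrix a c) (form_comp atlas c (lower a f)) k i j x"
    if "c \<in> atlas" "x \<in> snd c ` fst c" for c x k i j
    by (rule affine_connection_eq[OF D kropina_berwald_coeffs[OF F f eq] that])
  have ricci: "ricci (affine_connection atlas D F c) i j x = ricci (affine_connection atlas D F c) j i x \<longleftrightarrow>
      partial i (form_comp atlas c (lower a f) j) x = partial j (form_comp atlas c (lower a f) i) x"
    if c: "c \<in> atlas" and x: "x \<in> snd c ` fst c" for c x i j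
  proof -
    interpret weyl_coordinates "chart_image c (topspace M)" m "metric_matrix a c" "form_comp atlas c (lower a f)"
      by (rule weyl_coordinates_chart[OF openin_topspace a c f_smooth[OF c]])
    have xS: "x \<in> chart_image c (topspace M)" using x chart_image_topspace[OF c] by simp
    have "ricci (affine_connection atlas D F c) i j x =
        ricci (weyl_conn m (metric_matrix a c) (form_comp atlas c (lower a f))) i j x" for i j
      by (rule ricci_cong[OF open_chart_range[OF c] x aff[OF c]])
    \<comment> \<open>The antisymmetric part of the Ricci tensor is a multiple of the exterior
      derivative of \<open>f\<close>, with the nonzero constant \<open>m * CARD('n)\<close>.\<close>
    then show ?thesis using ricci_weyl_conn[OF xS, of i j] \<open>m \<noteq> 0\<close> by auto
  qed
  have ii_iii: "affine_ricci_symmetric atlas D F \<longleftrightarrow> closed_one_form atlas (topspace M) (lower a f)"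
    unfolding affine_ricci_symmetric_def closed_one_form_def
    using ricci chart_image_topspace by simp
  have potential: "\<exists>U \<psi>. openin M U \<and> p \<in> U \<and> potential_on atlas U (lower a f) \<psi>"
    if closed: "closed_one_form atlas (topspace M) (lower a f)" and p: "p \<in> topspace M" for p
  proof -
    have "smooth_one_form atlas (topspace M) (lower a f)"
      unfolding smooth_one_form_def
      using linear_form_lower[OF openin_topspace a f] f_smooth by blast
    from closed_one_form_potential[OF closed this p] show ?thesis by metis
  qed
  \<comment> \<open>Serves twice: with the local potentials of a closed form it gives (iii) to (i),
    and with an arbitrary potential it is the last claim of the theorem.\<close>
  have metrizes: "metrizes_on atlas D F U (\<lambda>p v w. exp (- 2 * m * \<psi> p) * a p v w)"
    if U: "openin M U" and \<psi>: "potential_on atlas U (lower a f) \<psi>" for U \<psi>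
  proof -
    have aU: "pseudo_riemannian_metric atlas U a" by (rule pseudo_riemannian_metric_subset[OF a U])
    have fU: "smooth_vector_field atlas U f" by (rule smooth_vector_field_subset[OF f U])
    show ?thesis
      unfolding metrizes_on_def
    proof (intro conjI ballI allI)
      show "pseudo_riemannian_metric atlas U (\<lambda>p v w. exp (- 2 * m * \<psi> p) * a p v w)"
        by (rule pseudo_riemannian_metric_conformal[OF aU U potential_smooth[OF \<psi>]])
      fix c x k i j assume c: "c \<in> atlas" and x: "x \<in> chart_image c U"
      then have "x \<in> snd c ` fst c" by auto
      then show "levi_civita atlas (\<lambda>p v w. exp (- 2 * m * \<psi> p) * a p v w) c k i j x = affine_connection atlas D F c k i j x"
        unfolding levi_civita_conformal[OF aU U fU \<psi> c x] by (rule aff[OF c, symmetric])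
    qed
  qed
  have "locally_metrizable M atlas D F" if "closed_one_form atlas (topspace M) (lower a f)"
    using potential[OF that] metrizes unfolding locally_metrizable_def by blast
  \<comment> \<open>Closes the circle: (i) gives (ii), which is equivalent to (iii), and (iii) has
    just been shown to give (i).\<close>
  then have i_ii: "locally_metrizable M atlas D F \<longleftrightarrow> affine_ricci_symmetric atlas D F"
    using locally_metrizable_imp_ricci_symmetric ii_iii by blast
  show ?thesis
    unfolding Let_def
  proof (intro conjI impI ballI allI; (elim conjE)?)
    show "locally_metrizable M atlas D F \<longleftrightarrow> affine_ricci_symmetric atlas D F" by (rule i_ii)
    show "affine_ricci_symmetric atlas D F \<longleftrightarrow> closed_one_form atlas (topspace M) (lower a f)" by (rule ii_iii)
    show "\<exists>U \<psi>. openin M U \<and> p \<in> U \<and> potential_on atlas U (lower a f) \<psi>"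
      if "closed_one_form atlas (topspace M) (lower a f)" "p \<in> topspace M" for p
      by (rule potential[OF that])
  next
    fix U \<psi> assume U: "openin M U" and \<psi>: "potential_on atlas U (lower a f) \<psi>"
    show "case z of (p, v) \<Rightarrow> p \<in> U \<longrightarrow> F (p, v) = kropina m (\<lambda>p v w. exp (- 2 * m * \<psi> p) * a p v w)
        (\<lambda>p v. exp (- (1 + m) * \<psi> p) * b p v) (p, v)" if "z \<in> D" for z
      using F_eq[OF that] by (cases z) (simp only: case_prod_conv kropina_beta_def kropina_rescale simp_thms)
    show "smooth_one_form atlas U (\<lambda>p v. exp (- (1 + m) * \<psi> p) * b p v)"
      by (rule smooth_one_form_rescale[OF b U potential_smooth[OF \<psi>]])
    show "covariantly_constant atlas U (\<lambda>p v w. exp (- 2 * m * \<psi> p) * a p v w)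
        (\<lambda>p v. exp (- (1 + m) * \<psi> p) * b p v)"
      by (rule rescaled_one_form_covariantly_constant[OF a b f eq U \<psi>])
    show "metrizes_on atlas D F U (\<lambda>p v w. exp (- 2 * m * \<psi> p) * a p v w)"
      by (rule metrizes[OF U \<psi>])
  qed
qed

end
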